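(* Let $n\ge 2$, let $K$ be a compact set in $\mathbb{R}^n$, and assume $K$ satisfies ECC at the point $x_0$. Then for any positive integer $m$, $\overline{\mathcal{H}(m,x_0,K)}\supset\mathcal{H}(x_0,K)$, where the closure is taken with respect to the sup norm on $K$; that is, for every $f\in\mathcal{H}(x_0,K)$ and every $\varepsilon>0$ there exists $g\in\mathcal{H}(m,x_0,K)$ with $\sup_{x\in K}|f(x)-g(x)|<\varepsilon$.
   Context: Functions are real-valued. ECC (external cone condition): a compact set $K\subset\mathbb{R}^n$ satisfies ECC at a point $x_0$ if there exists a closed solid truncated cone $W$ with vertex at $x_0$ such that $W\cap K=\{x_0\}$. Here a closed solid truncated cone with vertex $x_0$ is a set of the form $W=\{x_0\}\cup\{x_0+z : 0<|z|\le\rho,\ z/|z|\in D\}$ with $\rho>0$ and $D$ a closed spherical cap of positive radius (so with nonempty interior) in the unit sphere of $\mathbb{R}^n$. $\mathcal{H}(x_0,K)$ denotes the space of all functions $f$ on $K$ such that $f$ vanishes at $x_0$ and $f$ is the restriction to $K$ of a function harmonic in a neighborhood of $K$. $\mathcal{H}(m,x_0,K)$ denotes the space of all functions $f$ on $K$ such that $f$ is the restriction to $K$ of a function harmonic in a neighborhood of $K$ which, together with all its partial derivatives of order $\le m$, vanishes at $x_0$. *)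

theory Defs
  imports "HOL-Analysis.Analysis"
begin

definition partial_deriv :: "'a::euclidean_space \<Rightarrow> ('a \<Rightarrow> real) \<Rightarrow> 'a \<Rightarrow> real"
  where "partial_deriv b f x = deriv (\<lambda>t. f (x + t *\<^sub>R b)) 0"

(* The list of directions is applied from the right, and its length is the order of the derivative. *)
definition iter_partial :: "'a::euclidean_space list \<Rightarrow> ('a \<Rightarrow> real) \<Rightarrow> 'a \<Rightarrow> real"
  where "iter_partial bs f = foldr partial_deriv bs f"

(* The differentiability conjunct is needed because deriv is total: it asserts that each partial
   derivative up to order k exists. On an open U the values below depend only on f restricted to U. *)
definition Ck_on :: "nat \<Rightarrow> ('a::euclidean_space \<Rightarrow> real) \<Rightarrow> 'a set \<Rightarrow> bool"
  where "Ck_on k f U \<longleftrightarrow> (\<forall>bs. set bs \<subseteq> Basis \<longrightarrow>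
     (length bs \<le> k \<longrightarrow> continuous_on U (iter_partial bs f)) \<and>
     (length bs < k \<longrightarrow> (\<forall>b\<in>Basis. \<forall>x\<in>U.
        (\<lambda>t. iter_partial bs f (x + t *\<^sub>R b)) differentiable (at 0))))"

definition laplacian :: "('a::euclidean_space \<Rightarrow> real) \<Rightarrow> 'a \<Rightarrow> real"
  where "laplacian f x = (\<Sum>b\<in>Basis. iter_partial [b, b] f x)"

definition harmonic_on :: "('a::euclidean_space \<Rightarrow> real) \<Rightarrow> 'a set \<Rightarrow> bool"
  where "harmonic_on f U \<longleftrightarrow> open U \<and> Ck_on 2 f U \<and> (\<forall>x\<in>U. laplacian f x = 0)"

definition harmonic_near :: "('a::euclidean_space \<Rightarrow> real) \<Rightarrow> 'a set \<Rightarrow> bool"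
  where "harmonic_near h K \<longleftrightarrow> (\<exists>U. open U \<and> K \<subseteq> U \<and> harmonic_on h U)"

(* Functions on K are extensional functions: restrict h K is undefined outside K. *)
definition harm_space :: "'a::euclidean_space \<Rightarrow> 'a set \<Rightarrow> ('a \<Rightarrow> real) set"
  where "harm_space x0 K = {f. f x0 = 0 \<and> (\<exists>h. harmonic_near h K \<and> f = restrict h K)}"

(* The empty list of directions contributes the condition h x0 = 0. *)
definition harm_space_order :: "nat \<Rightarrow> 'a::euclidean_space \<Rightarrow> 'a set \<Rightarrow> ('a \<Rightarrow> real) set"
  where "harm_space_order m x0 K = {f. \<exists>h. harmonic_near h K \<and>
     (\<forall>bs. set bs \<subseteq> Basis \<and> length bs \<le> m \<longrightarrow> iter_partial bs h x0 = 0) \<and> f = restrict h K}"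

(* The radius r is measured by chord length, i.e. in the metric of the ambient space. *)
definition spherical_cap :: "'a::euclidean_space \<Rightarrow> real \<Rightarrow> 'a set"
  where "spherical_cap e r = sphere 0 1 \<inter> cball e r"

definition truncated_cone :: "'a::euclidean_space \<Rightarrow> real \<Rightarrow> 'a set \<Rightarrow> 'a set"
  where "truncated_cone x0 \<rho> D =
     {x0} \<union> {x0 + z |z. 0 < norm z \<and> norm z \<le> \<rho> \<and> z /\<^sub>R norm z \<in> D}"

definition ext_cone_condition :: "'a::euclidean_space set \<Rightarrow> 'a \<Rightarrow> bool"
  where "ext_cone_condition K x0 \<longleftrightarrow> (\<exists>\<rho> e r. \<rho> > 0 \<and> norm e = 1 \<and> r > 0 \<and>
     truncated_cone x0 \<rho> (spherical_cap e r) \<inter> K = {x0})"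

end

(* The m-jet of a harmonic function h at x0 is matched by the jet of a combination u of translates of
   the fundamental solution with poles in the exterior cone. If only the homogeneous part of degree
   k >= 1 is to be matched, u may be replaced by t^k (u((x - x0)/t) - u(0)): this keeps the jet, moves
   the poles to x0 + t y (off K), and tends to 0 uniformly on K as t -> 0, because (x - x0)/t stays away
   from the poles and the fundamental solution grows at most logarithmically. Subtracting these
   functions for k = 1, ..., m from h gives the approximant.

   That the jets match is a duality argument: a constant-coefficient operator L that annihilates all
   translates with poles in the cone annihilates the fundamental solution away from 0 (L of it is a
   polynomial times a power of |x|). Truncating the fundamental solution near 0 by its Taylor polynomial
   in |x|^2, the Laplacian becomes a compactly supported radial mollifier, h is locally a multiple of its
   convolution with it, and L h(0) = 0 follows from Green's identity, L of the truncated solution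
   being compactly supported. The same convolution shows that h is smooth. *)

theory Submission
  imports Defs
begin

section \<open>Calculus of iterated partial derivatives\<close>


text \<open>Rescaling the argument by 1/t multiplies a derivative of order j by t^(-j), so the
  factor t^k restores the jet in degree k alone. This is why the jet of \<open>h\<close> is treated
  one degree at a time, and why each homogeneous part must lie in the span separately; letting the
  scale of \<open>h\<close> vary isolates these parts. On K the rescaled argument has size O(1/t),
  so smallness requires growth slower than linear together with k >= 1. In dimension 1 the
  fundamental solution is 2 |x| and this breaks down. Order 0 stays outside the duality: it is met
  by subtracting a constant, and in the plane the logarithm is not a polynomial times a power of
  |x|, whereas all its derivatives are. Harmonicity is defined by continuous partial derivatives up
  to order 2 only, so the higher jet of \<open>h\<close> makes sense only once regularity is proved.
  A mollifier of finite class C^p, one for every p, is enough for that and keeps all kernels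
  explicit. The radii 1 and 2 that recur are the support of the mollifier and the domain it reads
  from when centred in the unit ball.\<close>

lemma eventually_line_in_open:
  fixes x b :: "'a::real_normed_vector"
  assumes "open U" "x \<in> U"
  shows "\<forall>\<^sub>F t in nhds 0. x + t *\<^sub>R b \<in> U"
proof -
  have "((\<lambda>t. x + t *\<^sub>R b) \<longlongrightarrow> x + 0 *\<^sub>R b) (nhds 0)"
    by (intro tendsto_intros filterlim_ident)
  then show ?thesis
    using assms by (auto dest: topological_tendstoD)
qed

lemma has_derivative_line_cong:
  fixes f g :: "'a::real_normed_vector \<Rightarrow> real"
  assumes "open U" "x \<in> U" "\<And>y. y \<in> U \<Longrightarrow> f y = g y"
  shows "((\<lambda>t. f (x + t *\<^sub>R b)) has_real_derivative D) (at 0) \<longleftrightarrow>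
         ((\<lambda>t. g (x + t *\<^sub>R b)) has_real_derivative D) (at 0)"
  by (rule DERIV_cong_ev)
     (use eventually_line_in_open[OF assms(1,2), of b] assms(3) in \<open>auto elim!: eventually_mono\<close>)

text \<open>Derivative hypotheses are stated at parameter 0; moving the base point transfers them
  along the whole line, as the mean value theorem and differentiation under the integral
  need.\<close>

lemma has_derivative_line_at:
  fixes f :: "'a::real_normed_vector \<Rightarrow> real"
  assumes "((\<lambda>t. f ((x + s *\<^sub>R b) + t *\<^sub>R b)) has_real_derivative D) (at 0)"
  shows "((\<lambda>t. f (x + t *\<^sub>R b)) has_real_derivative D) (at s)"
proof -
  have "((\<lambda>t. f (x + (t + s) *\<^sub>R b)) has_real_derivative D) (at 0)"
    using assms by (simp add: algebra_simps)
  then show ?thesis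
    using DERIV_shift[of "\<lambda>t. f (x + t *\<^sub>R b)" D 0 s] by simp
qed

lemma partial_deriv_eqI:
  "((\<lambda>t. f (x + t *\<^sub>R b)) has_real_derivative D) (at 0) \<Longrightarrow> partial_deriv b f x = D"
  unfolding partial_deriv_def by (rule DERIV_imp_deriv)

lemma partial_deriv_cong:
  assumes "open U" "x \<in> U" "\<And>y. y \<in> U \<Longrightarrow> f y = g y"
  shows "partial_deriv b f x = partial_deriv b g x"
  unfolding partial_deriv_def
  by (rule deriv_cong_ev)
     (use eventually_line_in_open[OF assms(1,2), of b] assms(3) in \<open>auto elim!: eventually_mono\<close>)

lemma iter_partial_Nil [simp]: "iter_partial [] f = f"
  by (simp add: iter_partial_def)

lemma iter_partial_Cons [simp]: "iter_partial (b # bs) f = partial_deriv b (iter_partial bs f)"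
  by (simp add: iter_partial_def)

lemma iter_partial_append: "iter_partial (as @ bs) f = iter_partial as (iter_partial bs f)"
  by (simp add: iter_partial_def)

lemma iter_partial_cong:
  assumes "open U" "\<And>y. y \<in> U \<Longrightarrow> f y = g y" "x \<in> U"
  shows "iter_partial bs f x = iter_partial bs g x"
  using assms(3)
proof (induction bs arbitrary: x)
  case (Cons b bs)
  then show ?case
    using partial_deriv_cong[OF assms(1), of x "iter_partial bs f" "iter_partial bs g"] by simp
qed (use assms in auto)

lemma iter_partial_vanishes:
  assumes "open U" "\<And>y. y \<in> U \<Longrightarrow> f y = 0" "x \<in> U"
  shows "iter_partial bs f x = 0"
  using assms(3)
proof (induction bs arbitrary: x)
  case (Cons b bs)
  then have "partial_deriv b (iter_partial bs f) x = partial_deriv b (\<lambda>_. 0) x"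
    by (intro partial_deriv_cong[OF assms(1)]) auto
  then show ?case by (simp add: partial_deriv_def)
qed (use assms in auto)

lemma Ck_on_continuous:
  "Ck_on k f U \<Longrightarrow> set bs \<subseteq> Basis \<Longrightarrow> length bs \<le> k \<Longrightarrow> continuous_on U (iter_partial bs f)"
  by (auto simp: Ck_on_def)

lemma Ck_on_continuous0: "Ck_on k f U \<Longrightarrow> continuous_on U f"
  using Ck_on_continuous[of k f U "[]"] by simp

lemma Ck_on_DERIV:
  assumes "Ck_on k f U" "set bs \<subseteq> Basis" "length bs < k" "b \<in> Basis" "x \<in> U"
  shows "((\<lambda>t. iter_partial bs f (x + t *\<^sub>R b)) has_real_derivative iter_partial (b # bs) f x) (at 0)"
proof -
  have "(\<lambda>t. iter_partial bs f (x + t *\<^sub>R b)) differentiable (at 0)"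
    using assms by (auto simp: Ck_on_def)
  then show ?thesis
    using DERIV_deriv_iff_real_differentiable by (auto simp: partial_deriv_def)
qed

lemma Ck_on_DERIV0:
  assumes "Ck_on k f U" "0 < k" "b \<in> Basis" "x \<in> U"
  shows "((\<lambda>t. f (x + t *\<^sub>R b)) has_real_derivative partial_deriv b f x) (at 0)"
  using Ck_on_DERIV[OF assms(1), of "[]" b x] assms by simp

lemma Ck_onI:
  assumes "\<And>bs. set bs \<subseteq> Basis \<Longrightarrow> length bs \<le> k \<Longrightarrow> continuous_on U (iter_partial bs f)"
    and "\<And>bs b x. set bs \<subseteq> Basis \<Longrightarrow> length bs < k \<Longrightarrow> b \<in> Basis \<Longrightarrow> x \<in> U \<Longrightarrow>
      \<exists>D. ((\<lambda>t. iter_partial bs f (x + t *\<^sub>R b)) has_real_derivative D) (at 0)"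
  shows "Ck_on k f U"
  unfolding Ck_on_def using assms by (auto simp: real_differentiable_def)

lemma Ck_on_mono: "Ck_on k f U \<Longrightarrow> j \<le> k \<Longrightarrow> V \<subseteq> U \<Longrightarrow> Ck_on j f V"
  unfolding Ck_on_def by (meson continuous_on_subset le_trans order.strict_trans2 subset_iff)

text \<open>\<open>G\<close> collects candidate values of all iterated partials at once. On an open
  set these values determine the derivatives along lines, so \<open>G\<close> may replace the
  iterated partials there too.\<close>

lemma Ck_on_transform:
  assumes "open U" and val: "\<And>bs x. set bs \<subseteq> Basis \<Longrightarrow> length bs \<le> k \<Longrightarrow> x \<in> U \<Longrightarrow> iter_partial bs f x = G bs x"
    and "\<And>bs. set bs \<subseteq> Basis \<Longrightarrow> length bs \<le> k \<Longrightarrow> continuous_on U (G bs)"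
    and "\<And>bs b x. set bs \<subseteq> Basis \<Longrightarrow> length bs < k \<Longrightarrow> b \<in> Basis \<Longrightarrow> x \<in> U \<Longrightarrow>
      \<exists>D. ((\<lambda>t. G bs (x + t *\<^sub>R b)) has_real_derivative D) (at 0)"
  shows "Ck_on k f U"
proof (rule Ck_onI)
  fix bs :: "'a list" assume bs: "set bs \<subseteq> Basis" "length bs \<le> k"
  show "continuous_on U (iter_partial bs f)"
    using assms(3)[OF bs] val[OF bs] by (simp cong: continuous_on_cong)
next
  fix bs :: "'a list" and b x :: 'a assume bs: "set bs \<subseteq> Basis" "length bs < k" "b \<in> Basis" "x \<in> U"
  then show "\<exists>D. ((\<lambda>t. iter_partial bs f (x + t *\<^sub>R b)) has_real_derivative D) (at 0)"
    using assms(4)[OF bs] has_derivative_line_cong[OF assms(1) bs(4), of "iter_partial bs f" "G bs"] val[of bs]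
    by auto
qed

lemma Ck_on_cong:
  assumes "open U" "\<And>y. y \<in> U \<Longrightarrow> f y = g y" "Ck_on k g U"
  shows "Ck_on k f U"
proof (rule Ck_on_transform[OF assms(1), where G = "\<lambda>bs. iter_partial bs g"])
  show "\<exists>D. ((\<lambda>t. iter_partial bs g (x + t *\<^sub>R b)) has_real_derivative D) (at 0)"
    if "set bs \<subseteq> Basis" "length bs < k" "b \<in> Basis" "x \<in> U" for bs b x
    using Ck_on_DERIV[OF assms(3) that] by (rule exI)
qed (rule iter_partial_cong[OF assms(1,2)] Ck_on_continuous[OF assms(3)]; assumption)+

text \<open>The first derivative taken is the last entry of the list; peeling off that end turns a
  claim of order k + 1 about \<open>f\<close> into one of order k about its first partials.\<close>

lemma Ck_on_SucI:
  assumes "open U" "continuous_on U f"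
    and part: "\<And>b x. b \<in> Basis \<Longrightarrow> x \<in> U \<Longrightarrow> ((\<lambda>t. f (x + t *\<^sub>R b)) has_real_derivative g b x) (at 0)"
    and Ck: "\<And>b. b \<in> Basis \<Longrightarrow> Ck_on k (g b) U"
  shows "Ck_on (Suc k) f U"
proof -
  have eq: "iter_partial (bs @ [b]) f x = iter_partial bs (g b) x" if "b \<in> Basis" "x \<in> U" for bs b x
    unfolding iter_partial_append
    by (rule iter_partial_cong[OF assms(1) _ that(2)]) (simp add: partial_deriv_eqI[OF part[OF that(1)]])
  show ?thesis
  proof (rule Ck_onI)
    fix bs :: "'a list" assume bs: "set bs \<subseteq> Basis" "length bs \<le> Suc k"
    show "continuous_on U (iter_partial bs f)"
    proof (cases bs rule: rev_cases)
      case (snoc cs c)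
      then show ?thesis
        using Ck_on_continuous[OF Ck, of c cs] bs eq[of c _ cs] by (simp cong: continuous_on_cong)
    qed (use assms in auto)
  next
    fix bs :: "'a list" and b x :: 'a assume bs: "set bs \<subseteq> Basis" "length bs < Suc k" "b \<in> Basis" "x \<in> U"
    show "\<exists>D. ((\<lambda>t. iter_partial bs f (x + t *\<^sub>R b)) has_real_derivative D) (at 0)"
    proof (cases bs rule: rev_cases)
      case (snoc cs c)
      then have c: "c \<in> Basis" "set cs \<subseteq> Basis" "length cs < k" using bs by auto
      show ?thesis
        using Ck_on_DERIV[OF Ck[OF c(1)] c(2,3) bs(3,4)] unfolding snoc
        using has_derivative_line_cong[OF assms(1) bs(4), of "iter_partial (cs @ [c]) f" "iter_partial cs (g c)"]
          eq[OF c(1)] by auto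
    qed (use part bs in auto)
  qed
qed

lemma Ck_on_partial:
  assumes "Ck_on (Suc k) f U" "b \<in> Basis"
  shows "Ck_on k (partial_deriv b f) U"
proof -
  have *: "iter_partial bs (partial_deriv b f) = iter_partial (bs @ [b]) f" for bs
    by (simp add: iter_partial_append)
  show ?thesis
  proof (rule Ck_onI; unfold *)
    show "continuous_on U (iter_partial (bs @ [b]) f)" if "set bs \<subseteq> Basis" "length bs \<le> k" for bs
      using Ck_on_continuous[OF assms(1), of "bs @ [b]"] that assms(2) by simp
    show "\<exists>D. ((\<lambda>t. iter_partial (bs @ [b]) f (x + t *\<^sub>R c)) has_real_derivative D) (at 0)"
      if "set bs \<subseteq> Basis" "length bs < k" "c \<in> Basis" "x \<in> U" for bs c x
      using Ck_on_DERIV[OF assms(1), of "bs @ [b]" c x] that assms(2) by auto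
  qed
qed

lemma Ck_on_iter_partial:
  assumes "Ck_on (k + length bs) f U" "set bs \<subseteq> Basis"
  shows "Ck_on k (iter_partial bs f) U"
  using assms
proof (induction bs arbitrary: k)
  case (Cons b bs)
  then show ?case using Ck_on_partial[of k "iter_partial bs f" U b] by simp
qed auto

lemma Ck_on_const [simp]: "Ck_on k (\<lambda>_. c) U"
proof (rule Ck_onI)
  have *: "iter_partial bs (\<lambda>_. c) = (\<lambda>_::'a. if bs = [] then c else 0)" for bs
    by (induction bs) (auto simp: partial_deriv_def fun_eq_iff)
  show "continuous_on U (iter_partial bs (\<lambda>_. c))" for bs
    unfolding * by simp
  show "\<exists>D. ((\<lambda>t. iter_partial bs (\<lambda>_. c) (x + t *\<^sub>R b)) has_real_derivative D) (at 0)" for bs and x b :: 'a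
    unfolding * by (auto intro!: exI[of _ 0])
qed

lemma iter_partial_const: "bs \<noteq> [] \<Longrightarrow> iter_partial bs (\<lambda>_. c) x = 0"
proof -
  have "iter_partial bs (\<lambda>_. c) = (\<lambda>_::'a. if bs = [] then c else 0)"
    by (induction bs) (auto simp: partial_deriv_def fun_eq_iff)
  then show "bs \<noteq> [] \<Longrightarrow> iter_partial bs (\<lambda>_. c) x = 0" by simp
qed

lemma Ck_on_inner: 
  assumes "open U" shows "Ck_on k (\<lambda>x. x \<bullet> a) U"
proof (cases k)
  case 0
  then show ?thesis by (auto intro!: Ck_onI continuous_intros)
next
  case (Suc j)
  show ?thesis unfolding Suc
    by (rule Ck_on_SucI[OF assms, where g = "\<lambda>b x. b \<bullet> a"])
       (auto intro!: continuous_intros derivative_eq_intros simp: inner_add_left)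
qed

lemma iter_partial_linear:
  assumes "open U" "Ck_on k f U" "Ck_on k g U" "set bs \<subseteq> Basis" "length bs \<le> k" "x \<in> U"
  shows "iter_partial bs (\<lambda>x. \<alpha> * f x + \<beta> * g x) x = \<alpha> * iter_partial bs f x + \<beta> * iter_partial bs g x"
  using assms(4-)
proof (induction bs arbitrary: x)
  case (Cons b bs)
  have "partial_deriv b (iter_partial bs (\<lambda>x. \<alpha> * f x + \<beta> * g x)) x
      = partial_deriv b (\<lambda>x. \<alpha> * iter_partial bs f x + \<beta> * iter_partial bs g x) x"
    by (rule partial_deriv_cong[OF assms(1)]) (use Cons in auto)
  also have "\<dots> = \<alpha> * iter_partial (b # bs) f x + \<beta> * iter_partial (b # bs) g x"
    by (intro partial_deriv_eqI DERIV_add DERIV_cmult Ck_on_DERIV[OF assms(2)] Ck_on_DERIV[OF assms(3)])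
       (use Cons in auto)
  finally show ?case by simp
qed auto

lemma Ck_on_linear:
  assumes "open U" "Ck_on k f U" "Ck_on k g U"
  shows "Ck_on k (\<lambda>x. \<alpha> * f x + \<beta> * g x) U"
proof (rule Ck_on_transform[OF assms(1), where G = "\<lambda>bs x. \<alpha> * iter_partial bs f x + \<beta> * iter_partial bs g x"])
  fix bs b x assume bs: "set bs \<subseteq> (Basis :: 'a set)" "length bs < k" "b \<in> (Basis :: 'a set)" "x \<in> U"
  show "\<exists>D. ((\<lambda>t. \<alpha> * iter_partial bs f (x + t *\<^sub>R b) + \<beta> * iter_partial bs g (x + t *\<^sub>R b))
      has_real_derivative D) (at 0)"
    using DERIV_add[OF DERIV_cmult DERIV_cmult, OF Ck_on_DERIV[OF assms(2) bs] Ck_on_DERIV[OF assms(3) bs]] ..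
qed (auto intro!: continuous_intros Ck_on_continuous[OF assms(2)] Ck_on_continuous[OF assms(3)]
      iter_partial_linear[OF assms])

lemma Ck_on_add: "open U \<Longrightarrow> Ck_on k f U \<Longrightarrow> Ck_on k g U \<Longrightarrow> Ck_on k (\<lambda>x. f x + g x) U"
  using Ck_on_linear[of U k f g 1 1] by simp

lemma Ck_on_sum:
  assumes "open U" "\<And>i. i \<in> A \<Longrightarrow> Ck_on k (f i) U"
  shows "Ck_on k (\<lambda>x. \<Sum>i\<in>A. c i * f i x) U"
  using assms(2)
proof (induction A rule: infinite_finite_induct)
  case (insert i A)
  then show ?case using Ck_on_linear[OF assms(1), of k "f i" "\<lambda>x. \<Sum>i\<in>A. c i * f i x" "c i" 1] by simp
qed auto

lemma iter_partial_sum: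
  assumes "open U" "\<And>i. i \<in> A \<Longrightarrow> Ck_on k (f i) U" "set bs \<subseteq> Basis" "length bs \<le> k" "x \<in> U"
  shows "iter_partial bs (\<lambda>x. \<Sum>i\<in>A. c i * f i x) x = (\<Sum>i\<in>A. c i * iter_partial bs (f i) x)"
  using assms(2)
proof (induction A rule: infinite_finite_induct)
  case (insert i A)
  then show ?case
    using iter_partial_linear[OF assms(1) _ Ck_on_sum[OF assms(1)] assms(3-5), of "f i" A f "c i" 1 c] by simp
\<comment> \<open>The sum over an infinite or empty index set is the constant function 0.\<close>
qed (cases "bs = []"; simp add: iter_partial_const)+

lemma Ck_on_mult:
  assumes "open U" "Ck_on k f U" "Ck_on k g U"
  shows "Ck_on k (\<lambda>x. f x * g x) U"
  using assms(2,3)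
proof (induction k arbitrary: f g)
  case 0
  then show ?case
    using Ck_on_continuous0[of 0 f U] Ck_on_continuous0[of 0 g U] by (auto intro!: Ck_onI continuous_intros)
next
  case (Suc k)
  show ?case
  proof (rule Ck_on_SucI[OF assms(1), where g = "\<lambda>b x. partial_deriv b f x * g x + f x * partial_deriv b g x"])
    show "continuous_on U (\<lambda>x. f x * g x)"
      by (intro continuous_intros Ck_on_continuous0[OF Suc.prems(1)] Ck_on_continuous0[OF Suc.prems(2)])
  next
    fix b x assume "b \<in> (Basis :: 'a set)" "x \<in> U"
    then show "((\<lambda>t. f (x + t *\<^sub>R b) * g (x + t *\<^sub>R b)) has_real_derivative
        partial_deriv b f x * g x + f x * partial_deriv b g x) (at 0)"
      by (auto intro!: derivative_eq_intros Ck_on_DERIV0[OF Suc.prems(1)] Ck_on_DERIV0[OF Suc.prems(2)])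
  next
    fix b assume b: "b \<in> (Basis :: 'a set)"
    have "Ck_on k f U" "Ck_on k g U"
      using Suc.prems Ck_on_mono by (meson le_SucI order_refl)+
    then show "Ck_on k (\<lambda>x. partial_deriv b f x * g x + f x * partial_deriv b g x) U"
      by (intro Ck_on_add[OF assms(1)] Suc.IH Ck_on_partial[OF Suc.prems(1) b] Ck_on_partial[OF Suc.prems(2) b])
  qed
qed

lemma iter_partial_affine:
  fixes f :: "'a::euclidean_space \<Rightarrow> real"
  assumes "open V" "Ck_on k f V" "set bs \<subseteq> Basis" "length bs \<le> k" "a + s *\<^sub>R x \<in> V"
  shows "iter_partial bs (\<lambda>x. f (a + s *\<^sub>R x)) x = s ^ length bs * iter_partial bs f (a + s *\<^sub>R x)"
  using assms(3-)
proof (induction bs arbitrary: x)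
  case (Cons b bs)
  have op: "open ((\<lambda>x. a + s *\<^sub>R x) -` V)"
    by (intro open_vimage assms(1) continuous_intros)
  have "partial_deriv b (iter_partial bs (\<lambda>x. f (a + s *\<^sub>R x))) x
      = partial_deriv b (\<lambda>x. s ^ length bs * iter_partial bs f (a + s *\<^sub>R x)) x"
    by (rule partial_deriv_cong[OF op]) (use Cons in auto)
  also have "\<dots> = s ^ length bs * (iter_partial (b # bs) f (a + s *\<^sub>R x) * s)"
  proof (rule partial_deriv_eqI, rule DERIV_cmult)
    \<comment> \<open>The point 0 is written \<open>s * 0\<close> so that the chain rule with inner
      map t -> s * t applies literally.\<close>
    have "((\<lambda>t. iter_partial bs f ((a + s *\<^sub>R x) + t *\<^sub>R b)) has_real_derivative
        iter_partial (b # bs) f (a + s *\<^sub>R x)) (at (s * 0))"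
      using Ck_on_DERIV[OF assms(2), of bs b "a + s *\<^sub>R x"] Cons.prems by simp
    from DERIV_chain2[OF this DERIV_cmult_Id]
    show "((\<lambda>t. iter_partial bs f (a + s *\<^sub>R (x + t *\<^sub>R b))) has_real_derivative
        iter_partial (b # bs) f (a + s *\<^sub>R x) * s) (at 0)"
      by (simp add: algebra_simps)
  qed
  finally show ?case by simp
qed auto

lemma Ck_on_affine:
  fixes f :: "'a::euclidean_space \<Rightarrow> real"
  assumes "open V" "Ck_on k f V" "open U" "\<And>x. x \<in> U \<Longrightarrow> a + s *\<^sub>R x \<in> V"
  shows "Ck_on k (\<lambda>x. f (a + s *\<^sub>R x)) U"
proof (rule Ck_on_transform[OF assms(3), where G = "\<lambda>bs x. s ^ length bs * iter_partial bs f (a + s *\<^sub>R x)"])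
  fix bs :: "'a list" assume bs: "set bs \<subseteq> Basis" "length bs \<le> k"
  show "continuous_on U (\<lambda>x. s ^ length bs * iter_partial bs f (a + s *\<^sub>R x))"
    by (intro continuous_intros continuous_on_compose2[OF Ck_on_continuous[OF assms(2) bs]])
       (use assms(4) in auto)
next
  fix bs b x assume bs: "set bs \<subseteq> (Basis::'a set)" "length bs < k" "b \<in> (Basis::'a set)" "x \<in> U"
  have "((\<lambda>t. iter_partial bs f ((a + s *\<^sub>R x) + t *\<^sub>R b)) has_real_derivative
      iter_partial (b # bs) f (a + s *\<^sub>R x)) (at (s * 0))"
    using Ck_on_DERIV[OF assms(2), of bs b "a + s *\<^sub>R x"] bs assms(4) by simp
  from DERIV_cmult[OF DERIV_chain2[OF this DERIV_cmult_Id], of "s ^ length bs"]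
  show "\<exists>D. ((\<lambda>t. s ^ length bs * iter_partial bs f (a + s *\<^sub>R (x + t *\<^sub>R b))) has_real_derivative D) (at 0)"
    by (auto simp: algebra_simps)
qed (use iter_partial_affine[OF assms(1,2)] assms(4) in auto)

section \<open>Radial functions and their Laplacian\<close>

lemma DERIV_inner_self_line:
  fixes x b :: "'a::real_inner"
  shows "((\<lambda>t. (x + t *\<^sub>R b) \<bullet> (x + t *\<^sub>R b)) has_real_derivative 2 * (x \<bullet> b)) (at 0)"
proof -
  have "(\<lambda>t. (x + t *\<^sub>R b) \<bullet> (x + t *\<^sub>R b)) = (\<lambda>t. x \<bullet> x + 2 * t * (x \<bullet> b) + t * t * (b \<bullet> b))"
    by (auto simp: algebra_simps inner_commute)
  then show ?thesis by (auto intro!: derivative_eq_intros)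
qed

lemma DERIV_radial:
  fixes x b :: "'a::real_inner"
  assumes "(\<phi> has_real_derivative D) (at (x \<bullet> x))"
  shows "((\<lambda>t. \<phi> ((x + t *\<^sub>R b) \<bullet> (x + t *\<^sub>R b))) has_real_derivative 2 * (x \<bullet> b) * D) (at 0)"
  using DERIV_chain2[OF _ DERIV_inner_self_line, of \<phi> D x b] assms by (simp add: mult.commute)

text \<open>A partial derivative in direction b turns \<phi>_0(|x|^2) into 2 (x . b)
  \<phi>_1(|x|^2), a linear form times a radial function again, so the induction passes to the
  shifted family.\<close>

lemma Ck_on_radial:
  fixes U :: "'a::euclidean_space set"
  assumes "open U"
    and "\<And>j x. j < k \<Longrightarrow> x \<in> U \<Longrightarrow> (\<phi> j has_real_derivative \<phi> (Suc j) (x \<bullet> x)) (at (x \<bullet> x))"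
    and "\<And>x. x \<in> U \<Longrightarrow> isCont (\<phi> k) (x \<bullet> x)"
  shows "Ck_on k (\<lambda>x. \<phi> 0 (x \<bullet> x)) U"
  using assms(2,3)
proof (induction k arbitrary: \<phi>)
  case 0
  have "continuous_on U (\<lambda>x. \<phi> 0 (x \<bullet> x))"
  proof -
    have "isCont (\<lambda>x. \<phi> 0 (x \<bullet> x)) x" if "x \<in> U" for x
      using isCont_o2[of x "\<lambda>x. x \<bullet> x" "\<phi> 0"] 0(2)[OF that] by (auto intro!: continuous_intros)
    then show ?thesis by (simp add: continuous_at_imp_continuous_on)
  qed
  then show ?case by (auto intro!: Ck_onI)
next
  case (Suc k)
  show ?case
  proof (rule Ck_on_SucI[OF assms(1), where g = "\<lambda>b x. 2 * ((x \<bullet> b) * \<phi> (Suc 0) (x \<bullet> x))"])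
    have "isCont (\<lambda>x. \<phi> 0 (x \<bullet> x)) x" if "x \<in> U" for x
      using isCont_o2[of x "\<lambda>x. x \<bullet> x" "\<phi> 0"] DERIV_isCont[OF Suc.prems(1)[OF _ that, of 0]]
      by (auto intro!: continuous_intros)
    then show "continuous_on U (\<lambda>x. \<phi> 0 (x \<bullet> x))"
      by (simp add: continuous_at_imp_continuous_on)
  next
    fix b x :: 'a assume "x \<in> U"
    then show "((\<lambda>t. \<phi> 0 ((x + t *\<^sub>R b) \<bullet> (x + t *\<^sub>R b))) has_real_derivative
        2 * ((x \<bullet> b) * \<phi> (Suc 0) (x \<bullet> x))) (at 0)"
      using DERIV_radial[OF Suc.prems(1)[of 0 x], of b] by (simp add: mult.assoc)
  next
    fix b :: 'a
    have "Ck_on k (\<lambda>x. \<phi> (Suc 0) (x \<bullet> x)) U"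
      using Suc.IH[of "\<lambda>j. \<phi> (Suc j)"] Suc.prems by simp
    then show "Ck_on k (\<lambda>x. 2 * ((x \<bullet> b) * \<phi> (Suc 0) (x \<bullet> x))) U"
      by (intro Ck_on_mult assms(1) Ck_on_inner Ck_on_const)
  qed
qed

text \<open>The radial variable is |x|^2 rather than |x|; this leaves no singular coefficient, so
  the formula holds at the origin as well.\<close>

lemma laplacian_radial:
  fixes x :: "'a::euclidean_space" and \<phi> \<phi>' :: "real \<Rightarrow> real"
  assumes "open U" "x \<in> U"
    and "\<And>x. x \<in> U \<Longrightarrow> (\<phi> has_real_derivative \<phi>' (x \<bullet> x)) (at (x \<bullet> x))"
    and "(\<phi>' has_real_derivative D) (at (x \<bullet> x))"
  shows "laplacian (\<lambda>x. \<phi> (x \<bullet> x)) x = 2 * DIM('a) * \<phi>' (x \<bullet> x) + 4 * (x \<bullet> x) * D"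
proof -
  have "iter_partial [b, b] (\<lambda>x. \<phi> (x \<bullet> x)) x = 2 * \<phi>' (x \<bullet> x) + 4 * (x \<bullet> b)^2 * D" if b: "b \<in> Basis" for b
  proof -
    have "iter_partial [b, b] (\<lambda>x. \<phi> (x \<bullet> x)) x = partial_deriv b (\<lambda>x. 2 * (x \<bullet> b) * \<phi>' (x \<bullet> x)) x"
      unfolding iter_partial_Cons iter_partial_Nil
      by (rule partial_deriv_cong[OF assms(1,2)]) (rule partial_deriv_eqI[OF DERIV_radial[OF assms(3)]])
    also have "\<dots> = 2 * \<phi>' (x \<bullet> x) + 4 * (x \<bullet> b)^2 * D"
    proof (rule partial_deriv_eqI)
      have "((\<lambda>t. 2 * ((x + t *\<^sub>R b) \<bullet> b)) has_real_derivative 2) (at 0)"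
        using b by (auto intro!: derivative_eq_intros simp: inner_add_left)
      from DERIV_mult[OF this DERIV_radial[OF assms(4)]]
      show "((\<lambda>t. 2 * ((x + t *\<^sub>R b) \<bullet> b) * \<phi>' ((x + t *\<^sub>R b) \<bullet> (x + t *\<^sub>R b))) has_real_derivative
          2 * \<phi>' (x \<bullet> x) + 4 * (x \<bullet> b)\<^sup>2 * D) (at 0)"
        by (simp add: power2_eq_square mult_ac)
    qed
    finally show ?thesis .
  qed
  then have "laplacian (\<lambda>x. \<phi> (x \<bullet> x)) x = (\<Sum>b\<in>Basis. 2 * \<phi>' (x \<bullet> x) + 4 * (x \<bullet> b)^2 * D)"
    unfolding laplacian_def by (rule sum.cong[OF refl])
  also have "\<dots> = 2 * DIM('a) * \<phi>' (x \<bullet> x) + 4 * (\<Sum>b\<in>Basis. (x \<bullet> b)^2) * D"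
    by (simp add: sum.distrib sum_distrib_left sum_distrib_right)
  also have "(\<Sum>b\<in>Basis. (x \<bullet> b)^2) = x \<bullet> x"
    by (subst euclidean_inner) (simp add: power2_eq_square)
  finally show ?thesis .
qed

section \<open>Symmetry of mixed partial derivatives\<close>

text \<open>The mean value theorem is applied twice: in direction \<open>a\<close> to the increment
  of \<open>g\<close> over \<open>s *\<^sub>R b\<close>, then in direction \<open>b\<close> to
  \<open>ga\<close>. Only derivatives along lines enter, which is what \<open>Ck_on\<close> provides
  directly.\<close>

lemma second_difference:
  fixes g :: "'a::real_normed_vector \<Rightarrow> real"
  assumes "0 < s"
    and U: "\<And>\<sigma> \<tau>. 0 \<le> \<sigma> \<Longrightarrow> \<sigma> \<le> s \<Longrightarrow> 0 \<le> \<tau> \<Longrightarrow> \<tau> \<le> s \<Longrightarrow> x + \<sigma> *\<^sub>R a + \<tau> *\<^sub>R b \<in> U"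
    and ga: "\<And>y. y \<in> U \<Longrightarrow> ((\<lambda>t. g (y + t *\<^sub>R a)) has_real_derivative ga y) (at 0)"
    and gab: "\<And>y. y \<in> U \<Longrightarrow> ((\<lambda>t. ga (y + t *\<^sub>R b)) has_real_derivative gab y) (at 0)"
  shows "\<exists>\<sigma> \<tau>. 0 \<le> \<sigma> \<and> \<sigma> \<le> s \<and> 0 \<le> \<tau> \<and> \<tau> \<le> s \<and>
    g (x + s *\<^sub>R a + s *\<^sub>R b) - g (x + s *\<^sub>R a) - g (x + s *\<^sub>R b) + g x = s * s * gab (x + \<sigma> *\<^sub>R a + \<tau> *\<^sub>R b)"
proof -
  define w where "w \<sigma> = g ((x + s *\<^sub>R b) + \<sigma> *\<^sub>R a) - g (x + \<sigma> *\<^sub>R a)" for \<sigma>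
  have dw: "(w has_real_derivative ga ((x + s *\<^sub>R b) + \<sigma> *\<^sub>R a) - ga (x + \<sigma> *\<^sub>R a)) (at \<sigma>)"
    if "0 \<le> \<sigma>" "\<sigma> \<le> s" for \<sigma>
  proof -
    have "x + s *\<^sub>R b + \<sigma> *\<^sub>R a \<in> U"
      using U[OF that, of s] assms(1) by (simp add: add.assoc add.commute[of "s *\<^sub>R b"])
    moreover have "x + \<sigma> *\<^sub>R a \<in> U"
      using U[OF that, of 0] assms(1) by simp
    ultimately show ?thesis
      unfolding w_def by (intro DERIV_diff; intro has_derivative_line_at[OF ga])
  qed
  obtain \<sigma> where \<sigma>: "0 < \<sigma>" "\<sigma> < s" "w s - w 0 = s * (ga ((x + s *\<^sub>R b) + \<sigma> *\<^sub>R a) - ga (x + \<sigma> *\<^sub>R a))"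
    using MVT2[OF assms(1) dw] by auto
  have dga: "((\<lambda>\<tau>. ga ((x + \<sigma> *\<^sub>R a) + \<tau> *\<^sub>R b)) has_real_derivative gab ((x + \<sigma> *\<^sub>R a) + \<tau> *\<^sub>R b)) (at \<tau>)"
    if "0 \<le> \<tau>" "\<tau> \<le> s" for \<tau>
    by (rule has_derivative_line_at[OF gab]) (use U[of \<sigma> \<tau>] that \<sigma> in \<open>auto simp: algebra_simps\<close>)
  obtain \<tau> where \<tau>: "0 < \<tau>" "\<tau> < s"
    "ga ((x + \<sigma> *\<^sub>R a) + s *\<^sub>R b) - ga (x + \<sigma> *\<^sub>R a) = s * gab ((x + \<sigma> *\<^sub>R a) + \<tau> *\<^sub>R b)"
    using MVT2[OF assms(1) dga] by auto
  have "g (x + s *\<^sub>R a + s *\<^sub>R b) - g (x + s *\<^sub>R a) - g (x + s *\<^sub>R b) + g x = w s - w 0"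
    unfolding w_def by (simp add: add.assoc add.commute[of "s *\<^sub>R a"])
  also have "\<dots> = s * (s * gab ((x + \<sigma> *\<^sub>R a) + \<tau> *\<^sub>R b))"
    unfolding \<sigma>(3) \<tau>(3)[symmetric] by (simp add: algebra_simps)
  finally show ?thesis using \<sigma> \<tau> by (intro exI[of _ \<sigma>] exI[of _ \<tau>]) simp
qed

text \<open>One symmetric second difference is s^2 times a value of either mixed derivative near x,
  and both mixed derivatives are continuous at x.\<close>

lemma partial_deriv_commute:
  fixes g :: "'a::euclidean_space \<Rightarrow> real"
  assumes "open U" "Ck_on 2 g U" "a \<in> Basis" "b \<in> Basis" "x \<in> U"
  shows "partial_deriv a (partial_deriv b g) x = partial_deriv b (partial_deriv a g) x"
proof (rule ccontr)
  let ?A = "iter_partial [b, a] g" and ?B = "iter_partial [a, b] g"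
  assume "\<not> ?thesis"
  then have ne: "?A x \<noteq> ?B x" by auto
  \<comment> \<open>Half of the gap, so that no common value can be closer than this to both
    numbers.\<close>
  define \<epsilon> where "\<epsilon> = \<bar>?A x - ?B x\<bar> / 2"
  have "\<epsilon> > 0" using ne by (simp add: \<epsilon>_def)
  have "isCont ?A x" "isCont ?B x"
    using Ck_on_continuous[OF assms(2), of "[b,a]"] Ck_on_continuous[OF assms(2), of "[a,b]"] assms
    by (auto simp: continuous_on_eq_continuous_at)
  then obtain d1 d2 where d12: "d1 > 0" "\<And>y. dist y x < d1 \<Longrightarrow> dist (?A y) (?A x) < \<epsilon>"
    "d2 > 0" "\<And>y. dist y x < d2 \<Longrightarrow> dist (?B y) (?B x) < \<epsilon>"
    using \<open>\<epsilon> > 0\<close> unfolding continuous_at_eps_delta by metis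
  obtain d0 where d0: "d0 > 0" "\<And>y. dist y x < d0 \<Longrightarrow> y \<in> U"
    using assms(1,5) unfolding open_dist by blast
  define d where "d = Min {d0, d1, d2}"
  have d: "d > 0" "\<And>y. dist y x < d \<Longrightarrow> y \<in> U \<and> dist (?A y) (?A x) < \<epsilon> \<and> dist (?B y) (?B x) < \<epsilon>"
    using d0 d12 unfolding d_def by auto
  \<comment> \<open>The parallelogram with sides of length s stays within 2 s = d / 2 of x.\<close>
  define s where "s = d / 4"
  have s: "0 < s" using d by (simp add: s_def)
  have near: "dist (x + \<sigma> *\<^sub>R a + \<tau> *\<^sub>R b) x < d" if "0 \<le> \<sigma>" "\<sigma> \<le> s" "0 \<le> \<tau>" "\<tau> \<le> s" for \<sigma> \<tau>
  proof -
    have "norm (\<sigma> *\<^sub>R a + \<tau> *\<^sub>R b) \<le> \<sigma> + \<tau>"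
      using norm_triangle_ineq[of "\<sigma> *\<^sub>R a" "\<tau> *\<^sub>R b"] that assms by simp
    then show ?thesis using that d(1) by (simp add: dist_norm s_def add.assoc)
  qed
  have near': "dist (x + \<sigma> *\<^sub>R b + \<tau> *\<^sub>R a) x < d" if "0 \<le> \<sigma>" "\<sigma> \<le> s" "0 \<le> \<tau>" "\<tau> \<le> s" for \<sigma> \<tau>
    using near[OF that(3,4,1,2)] by (simp add: algebra_simps)
  have D: "((\<lambda>t. g (y + t *\<^sub>R c)) has_real_derivative partial_deriv c g y) (at 0)"
    "((\<lambda>t. partial_deriv c g (y + t *\<^sub>R c')) has_real_derivative iter_partial [c', c] g y) (at 0)"
    if "y \<in> U" "c \<in> Basis" "c' \<in> Basis" for y c c'
    using Ck_on_DERIV0[OF assms(2) _ that(2,1)] Ck_on_DERIV[OF assms(2), of "[c]" c' y] that by auto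
  obtain \<sigma> \<tau> where 1: "0 \<le> \<sigma>" "\<sigma> \<le> s" "0 \<le> \<tau>" "\<tau> \<le> s"
    "g (x + s *\<^sub>R a + s *\<^sub>R b) - g (x + s *\<^sub>R a) - g (x + s *\<^sub>R b) + g x = s * s * ?A (x + \<sigma> *\<^sub>R a + \<tau> *\<^sub>R b)"
    by (rule exE[OF second_difference[OF s, of x a b U g "partial_deriv a g" ?A]])
       (use near d(2) D[OF _ assms(3,4)] in auto)
  obtain \<sigma>' \<tau>' where 2: "0 \<le> \<sigma>'" "\<sigma>' \<le> s" "0 \<le> \<tau>'" "\<tau>' \<le> s"
    "g (x + s *\<^sub>R b + s *\<^sub>R a) - g (x + s *\<^sub>R b) - g (x + s *\<^sub>R a) + g x = s * s * ?B (x + \<sigma>' *\<^sub>R b + \<tau>' *\<^sub>R a)"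
    by (rule exE[OF second_difference[OF s, of x b a U g "partial_deriv b g" ?B]])
       (use near' d(2) D[OF _ assms(4,3)] in auto)
  have "g (x + s *\<^sub>R b + s *\<^sub>R a) = g (x + s *\<^sub>R a + s *\<^sub>R b)" by (simp add: algebra_simps)
  then have "s * s * ?A (x + \<sigma> *\<^sub>R a + \<tau> *\<^sub>R b) = s * s * ?B (x + \<sigma>' *\<^sub>R b + \<tau>' *\<^sub>R a)"
    using 1(5) 2(5) by linarith
  then have "?A (x + \<sigma> *\<^sub>R a + \<tau> *\<^sub>R b) = ?B (x + \<sigma>' *\<^sub>R b + \<tau>' *\<^sub>R a)" using s by simp
  moreover have "dist (?A (x + \<sigma> *\<^sub>R a + \<tau> *\<^sub>R b)) (?A x) < \<epsilon>" "dist (?B (x + \<sigma>' *\<^sub>R b + \<tau>' *\<^sub>R a)) (?B x) < \<epsilon>"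
    using d(2)[OF near[OF 1(1-4)]] d(2)[OF near'[OF 2(1-4)]] by auto
  moreover have "\<bar>?A x - ?B x\<bar> \<le> dist u (?A x) + dist u (?B x)" for u
    by (simp add: dist_real_def)
  ultimately show False unfolding \<epsilon>_def by (smt (verit) field_sum_of_halves)
qed

lemma iter_partial_snoc_commute:
  fixes g :: "'a::euclidean_space \<Rightarrow> real"
  assumes "open U" "c \<in> Basis" "set bs \<subseteq> Basis" "Ck_on (Suc (length bs)) g U" "x \<in> U"
  shows "iter_partial bs (partial_deriv c g) x = partial_deriv c (iter_partial bs g) x"
  using assms(3-)
proof (induction bs arbitrary: x)
  case (Cons b bs)
  have g: "Ck_on (Suc (length bs)) g U" "Ck_on (2 + length bs) g U"
    using Cons.prems(2) by (auto intro: Ck_on_mono)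
  have "iter_partial (b # bs) (partial_deriv c g) x = partial_deriv b (partial_deriv c (iter_partial bs g)) x"
    by simp (rule partial_deriv_cong[OF assms(1)], use Cons g in auto)
  also have "\<dots> = partial_deriv c (partial_deriv b (iter_partial bs g)) x"
    by (rule partial_deriv_commute[OF assms(1) Ck_on_iter_partial[OF g(2)]]) (use Cons assms in auto)
  finally show ?case by simp
qed auto

text \<open>This is where symmetry of mixed partials pays off: derivatives of the mollifier become
  Laplacians of derivatives of the truncated solution.\<close>

lemma iter_partial_laplacian:
  fixes g :: "'a::euclidean_space \<Rightarrow> real"
  assumes "open U" "set bs \<subseteq> Basis" "Ck_on (2 + length bs) g U" "x \<in> U"
  shows "iter_partial bs (laplacian g) x = laplacian (iter_partial bs g) x"
proof -
  have g: "Ck_on (Suc (length bs)) (partial_deriv c g) U" "Ck_on (length bs) (partial_deriv c (partial_deriv c g)) U"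
    "Ck_on (Suc (length bs)) g U"
    if "c \<in> Basis" for c
    using Ck_on_partial[OF Ck_on_partial[OF _ that] that, of "length bs" g U]
      Ck_on_partial[OF _ that, of "Suc (length bs)" g U] assms(3) by (auto intro: Ck_on_mono)
  have eq: "laplacian g = (\<lambda>x. \<Sum>c\<in>Basis. 1 * partial_deriv c (partial_deriv c g) x)"
    by (auto simp: laplacian_def)
  have "iter_partial bs (laplacian g) x = (\<Sum>c\<in>Basis. 1 * iter_partial bs (partial_deriv c (partial_deriv c g)) x)"
    unfolding eq by (rule iter_partial_sum[OF assms(1) g(2) assms(2) order_refl assms(4)]) auto
  also have "\<dots> = (\<Sum>c\<in>Basis. partial_deriv c (partial_deriv c (iter_partial bs g)) x)"
  proof (rule sum.cong[OF refl])
    fix c :: 'a assume c: "c \<in> Basis"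
    have "iter_partial bs (partial_deriv c (partial_deriv c g)) x = partial_deriv c (iter_partial bs (partial_deriv c g)) x"
      by (rule iter_partial_snoc_commute[OF assms(1) c assms(2) g(1)[OF c] assms(4)])
    also have "\<dots> = partial_deriv c (partial_deriv c (iter_partial bs g)) x"
      by (rule partial_deriv_cong[OF assms(1,4)]) (rule iter_partial_snoc_commute[OF assms(1) c assms(2) g(3)[OF c]])
    finally show "1 * iter_partial bs (partial_deriv c (partial_deriv c g)) x = \<dots>" by simp
  qed
  finally show ?thesis by (simp add: laplacian_def)
qed

section \<open>Integration by parts and convolution\<close>


lemma continuous_vanishing_bounded:
  fixes f :: "'a::euclidean_space \<Rightarrow> real"
  assumes "continuous_on UNIV f" "\<And>y. norm y > R \<Longrightarrow> f y = 0"
  obtains B where "B \<ge> 0" "\<And>y. \<bar>f y\<bar> \<le> B"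
proof -
  have "compact (f ` cball 0 R)"
    by (rule compact_continuous_image[OF continuous_on_subset[OF assms(1)]]) auto
  from compact_imp_bounded[OF this] have "\<exists>B. \<forall>y\<in>f ` cball 0 R. norm y \<le> B"
    unfolding bounded_iff .
  then obtain B where B: "\<And>y. y \<in> cball 0 R \<Longrightarrow> \<bar>f y\<bar> \<le> B"
    by (metis imageI real_norm_def)
  have "\<bar>f y\<bar> \<le> max B 0" for y
    using B[of y] assms(2)[of y] by (cases "norm y > R") auto
  then show ?thesis by (intro that[of "max B 0"]) auto
qed

lemma continuous_vanishing_integrable:
  fixes f :: "'a::euclidean_space \<Rightarrow> real"
  assumes "continuous_on UNIV f" "\<And>y. norm y > R \<Longrightarrow> f y = 0"
  shows "integrable lborel f"
proof -
  have "f = (\<lambda>y. indicator (cball 0 R) y *\<^sub>R f y)"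
    using assms(2) by (auto simp: indicator_def fun_eq_iff)
  moreover have "integrable lborel (\<lambda>y. indicator (cball 0 R) y *\<^sub>R f y)"
    by (intro borel_integrable_compact continuous_on_subset[OF assms(1)]) auto
  ultimately show ?thesis by simp
qed

lemma continuous_on_extend_zero:
  fixes f :: "'a::euclidean_space \<Rightarrow> real"
  assumes "open U" "cball 0 R \<subseteq> U" "continuous_on U f" "\<And>y. norm y > R \<Longrightarrow> f y = 0"
  shows "continuous_on UNIV f"
proof -
  have "continuous_on (- cball 0 R) f"
    using assms(4) by (subst continuous_on_cong[OF refl, of _ f "\<lambda>_. 0"]) auto
  then have "continuous_on (U \<union> - cball 0 R) f"
    using assms by (intro continuous_on_open_Un) auto
  moreover have "U \<union> - cball 0 R = UNIV" using assms(2) by auto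
  ultimately show ?thesis by simp
qed

text \<open>The mean value bound dominates all difference quotients with |t| <= 1 by
  \<open>D\<close>, so dominated convergence applies along every sequence tending to 0.\<close>

lemma DERIV_integral:
  fixes G :: "real \<Rightarrow> 'a \<Rightarrow> real"
  assumes int: "\<And>t. integrable M (G t)" and D: "integrable M D"
    and deriv: "\<And>t z. \<bar>t\<bar> \<le> 1 \<Longrightarrow> z \<in> space M \<Longrightarrow> ((\<lambda>t. G t z) has_real_derivative G' t z) (at t)"
    and bound: "\<And>t z. \<bar>t\<bar> \<le> 1 \<Longrightarrow> z \<in> space M \<Longrightarrow> \<bar>G' t z\<bar> \<le> D z"
    and meas: "G' 0 \<in> borel_measurable M"
  shows "((\<lambda>t. \<integral>z. G t z \<partial>M) has_real_derivative (\<integral>z. G' 0 z \<partial>M)) (at 0)"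
proof -
  have diff: "\<bar>G t z - G 0 z\<bar> \<le> D z * \<bar>t\<bar>" if "\<bar>t\<bar> \<le> 1" "z \<in> space M" for t z
  proof -
    have "norm (G t z - G 0 z) \<le> D z * norm (t - 0)"
    proof (rule field_differentiable_bound[where S = "{-1..1}" and f = "\<lambda>t. G t z" and f' = "\<lambda>t. G' t z"])
      fix u :: real assume "u \<in> {-1..1}"
      then have u: "\<bar>u\<bar> \<le> 1" by auto
      show "((\<lambda>t. G t z) has_real_derivative G' u z) (at u within {-1..1})"
        by (rule has_field_derivative_at_within[OF deriv[OF u that(2)]])
      show "norm (G' u z) \<le> D z" using bound[OF u that(2)] by simp
    qed (use that(1) in auto)
    then show ?thesis by simp
  qed
  have "((\<lambda>t. ((\<integral>z. G t z \<partial>M) - (\<integral>z. G 0 z \<partial>M)) / t) \<longlongrightarrow> (\<integral>z. G' 0 z \<partial>M)) (at 0)"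
    unfolding tendsto_at_iff_sequentially
  proof (intro allI impI)
    fix X :: "nat \<Rightarrow> real" assume X: "\<forall>i. X i \<in> UNIV - {0}" "X \<longlonglongrightarrow> 0"
    \<comment> \<open>The domination is available for |t| <= 1, so the finitely many earlier terms
      are dropped.\<close>
    obtain N where N: "\<And>i. i \<ge> N \<Longrightarrow> \<bar>X i\<bar> < 1"
      using X(2) by (metis LIMSEQ_iff diff_zero real_norm_def zero_less_one)
    have "(\<lambda>i. \<integral>z. (G (X (i + N)) z - G 0 z) / X (i + N) \<partial>M) \<longlonglongrightarrow> (\<integral>z. G' 0 z \<partial>M)"
    proof (rule integral_dominated_convergence[where w = D])
      show "AE z in M. (\<lambda>i. (G (X (i + N)) z - G 0 z) / X (i + N)) \<longlonglongrightarrow> G' 0 z"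
      proof (rule AE_I2)
        fix z assume z: "z \<in> space M"
        have "((\<lambda>t. (G t z - G 0 z) / t) \<longlongrightarrow> G' 0 z) (at 0)"
          using deriv[OF _ z, of 0] by (simp add: DERIV_def)
        moreover have "(\<lambda>i. X (i + N)) \<longlonglongrightarrow> 0" using X(2) by (rule LIMSEQ_ignore_initial_segment)
        ultimately show "(\<lambda>i. (G (X (i + N)) z - G 0 z) / X (i + N)) \<longlonglongrightarrow> G' 0 z"
          unfolding tendsto_at_iff_sequentially
          using X(1) by (auto simp: comp_def dest!: spec[of _ "\<lambda>i. X (i + N)"])
      qed
      show "AE z in M. norm ((G (X (i + N)) z - G 0 z) / X (i + N)) \<le> D z" for i
        using diff[of "X (i + N)"] N[of "i + N"] X(1) by (auto intro!: AE_I2 simp: field_simps)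
    qed (use meas D int in auto)
    then have "(\<lambda>i. ((\<integral>z. G (X (i + N)) z \<partial>M) - (\<integral>z. G 0 z \<partial>M)) / X (i + N)) \<longlonglongrightarrow> (\<integral>z. G' 0 z \<partial>M)"
      using int by simp
    from LIMSEQ_offset[OF this]
    show "((\<lambda>t. ((\<integral>z. G t z \<partial>M) - (\<integral>z. G 0 z \<partial>M)) / t) \<circ> X) \<longlonglongrightarrow> (\<integral>z. G' 0 z \<partial>M)"
      by (simp add: comp_def)
  qed
  then show ?thesis by (simp add: DERIV_def)
qed

lemma integral_translate:
  fixes f :: "'a::euclidean_space \<Rightarrow> real"
  assumes "f \<in> borel_measurable borel"
  shows "(\<integral>y. f (c + y) \<partial>lborel) = (\<integral>y. f y \<partial>lborel)"
proof -
  have "(\<integral>y. f y \<partial>lborel) = (\<integral>y. f y \<partial>distr lborel borel ((+) c))"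
    by (simp add: lborel_distr_plus)
  also have "\<dots> = (\<integral>y. f (c + y) \<partial>lborel)"
    using assms by (intro integral_distr) auto
  finally show ?thesis by simp
qed

text \<open>Translation invariance makes the integral of F (y + t b) independent of t, so its
  derivative at 0, the integral of \<open>F'\<close>, vanishes.\<close>

lemma integral_line_derivative_zero:
  fixes F :: "'a::euclidean_space \<Rightarrow> real"
  assumes F: "continuous_on UNIV F" "\<And>y. norm y > R \<Longrightarrow> F y = 0"
    and F': "continuous_on UNIV F'" "\<And>y. norm y > R \<Longrightarrow> F' y = 0"
    and deriv: "\<And>y. ((\<lambda>t. F (y + t *\<^sub>R b)) has_real_derivative F' y) (at 0)"
  shows "(\<integral>y. F' y \<partial>lborel) = 0"
proof -
  obtain B where B: "B \<ge> 0" "\<And>y. \<bar>F' y\<bar> \<le> B"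
    using continuous_vanishing_bounded[OF F'] by blast
  \<comment> \<open>For |t| <= 1 the function y -> F' (y + t b) vanishes outside the ball of radius
    R + norm b.\<close>
  define D where "D y = B * indicator (cball 0 (R + norm b)) y" for y :: 'a
  have "((\<lambda>t. \<integral>y. F (y + t *\<^sub>R b) \<partial>lborel) has_real_derivative (\<integral>y. F' (y + 0 *\<^sub>R b) \<partial>lborel)) (at 0)"
  proof (rule DERIV_integral[where D = D])
    show "integrable lborel D"
      unfolding D_def using emeasure_compact_finite[OF compact_cball, of "0::'a" "R + norm b"]
      by (intro integrable_mult_right integrable_real_indicator) auto
    show "integrable lborel (\<lambda>y. F (y + t *\<^sub>R b))" for t
    proof (rule continuous_vanishing_integrable[where R = "R + \<bar>t\<bar> * norm b"])
      show "continuous_on UNIV (\<lambda>y. F (y + t *\<^sub>R b))"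
        by (intro continuous_on_compose2[OF F(1)] continuous_intros) auto
      fix y :: 'a assume "norm y > R + \<bar>t\<bar> * norm b"
      moreover have "norm y \<le> norm (y + t *\<^sub>R b) + norm (t *\<^sub>R b)"
        using norm_triangle_ineq4[of "y + t *\<^sub>R b" "t *\<^sub>R b"] by simp
      ultimately show "F (y + t *\<^sub>R b) = 0" by (intro F(2)) auto
    qed
    show "((\<lambda>t. F (y + t *\<^sub>R b)) has_real_derivative F' (y + t *\<^sub>R b)) (at t)" for t and y :: 'a
      by (rule has_derivative_line_at[OF deriv])
    show "\<bar>F' (y + t *\<^sub>R b)\<bar> \<le> D y" if "\<bar>t\<bar> \<le> 1" for t and y :: 'a
    proof (cases "norm y \<le> R + norm b")
      case True
      then show ?thesis using B by (simp add: D_def)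
    next
      case False
      have "norm (t *\<^sub>R b) \<le> norm b" using that by (simp add: mult_left_le_one_le)
      moreover have "norm y \<le> norm (y + t *\<^sub>R b) + norm (t *\<^sub>R b)"
        using norm_triangle_ineq4[of "y + t *\<^sub>R b" "t *\<^sub>R b"] by simp
      ultimately have "F' (y + t *\<^sub>R b) = 0" using False by (intro F'(2)) auto
      then show ?thesis using B by (simp add: D_def)
    qed
    show "(\<lambda>y. F' (y + 0 *\<^sub>R b)) \<in> borel_measurable lborel"
      using F'(1) by (auto intro!: borel_measurable_continuous_onI)
  qed
  moreover have "(\<integral>y. F (y + t *\<^sub>R b) \<partial>lborel) = (\<integral>y. F y \<partial>lborel)" for t
    using integral_translate[of F "t *\<^sub>R b"] F(1)
    by (simp add: add.commute borel_measurable_continuous_onI)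
  ultimately have "((\<lambda>t::real. \<integral>y. F y \<partial>lborel) has_real_derivative (\<integral>y. F' y \<partial>lborel)) (at 0)"
    by simp
  then show ?thesis using DERIV_unique[OF _ DERIV_const] by blast
qed

text \<open>\<open>h\<close> is arbitrary outside \<open>U\<close>; the factor \<open>g\<close>
  suppresses those values, so integrals may run over the whole space.\<close>

lemma mult_extend_zero:
  fixes h g :: "'a::euclidean_space \<Rightarrow> real"
  assumes "open U" "cball 0 R \<subseteq> U" "continuous_on U h" "continuous_on UNIV g" "\<And>y. norm y > R \<Longrightarrow> g y = 0"
  shows "continuous_on UNIV (\<lambda>y. h y * g y)" "integrable lborel (\<lambda>y. h y * g y)"
proof -
  show c: "continuous_on UNIV (\<lambda>y. h y * g y)"
    by (rule continuous_on_extend_zero[OF assms(1,2)])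
       (use assms in \<open>auto intro!: continuous_intros intro: continuous_on_subset\<close>)
  show "integrable lborel (\<lambda>y. h y * g y)"
    by (rule continuous_vanishing_integrable[OF c, of R]) (use assms in auto)
qed

lemma integral_by_parts_partial:
  fixes h g :: "'a::euclidean_space \<Rightarrow> real"
  assumes U: "open U" "cball 0 R \<subseteq> U"
    and h: "Ck_on 1 h U" and g: "Ck_on 1 g UNIV" "\<And>y. norm y > R \<Longrightarrow> g y = 0" and b: "b \<in> Basis"
  shows "(\<integral>y. h y * partial_deriv b g y \<partial>lborel) = - (\<integral>y. partial_deriv b h y * g y \<partial>lborel)"
proof -
  have g': "partial_deriv b g y = 0" if "norm y > R" for y
    using iter_partial_vanishes[of "- cball 0 R" g y "[b]"] g(2) that by auto
  have cont: "continuous_on U h" "continuous_on U (partial_deriv b h)" "continuous_on UNIV g"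
    "continuous_on UNIV (partial_deriv b g)"
    using Ck_on_continuous[OF h, of "[]"] Ck_on_continuous[OF h, of "[b]"] 
      Ck_on_continuous[OF g(1), of "[]"] Ck_on_continuous[OF g(1), of "[b]"] b by auto
  note hg' = mult_extend_zero[OF U cont(1,4) g']
  note h'g = mult_extend_zero[OF U cont(2,3) g(2)]
  note hg = mult_extend_zero[OF U cont(1,3) g(2)]
  have "(\<integral>y. partial_deriv b h y * g y + h y * partial_deriv b g y \<partial>lborel) = 0"
  proof (rule integral_line_derivative_zero[where R = R and b = b and F = "\<lambda>y. h y * g y"])
    show "continuous_on UNIV (\<lambda>y. partial_deriv b h y * g y + h y * partial_deriv b g y)"
      by (intro continuous_on_add h'g hg')
    show "((\<lambda>t. h (y + t *\<^sub>R b) * g (y + t *\<^sub>R b)) has_real_derivative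
        partial_deriv b h y * g y + h y * partial_deriv b g y) (at 0)" for y
    proof (cases "norm y > R")
      \<comment> \<open>Here \<open>h\<close> may fail to be differentiable, but the product
        vanishes near y.\<close>
      case True
      have "((\<lambda>t. h (y + t *\<^sub>R b) * g (y + t *\<^sub>R b)) has_real_derivative 0) (at 0) \<longleftrightarrow>
          ((\<lambda>t. (\<lambda>y. 0) (y + t *\<^sub>R b)) has_real_derivative 0) (at 0)"
        by (rule has_derivative_line_cong[of "- cball 0 R" y "\<lambda>y. h y * g y" "\<lambda>_. 0"]) (use g True in auto)
      then show ?thesis using True g(2) g' by simp
    next
      case False
      then have "y \<in> U" using U by auto
      then show ?thesis
        using DERIV_mult[OF Ck_on_DERIV0[OF h _ b] Ck_on_DERIV0[OF g(1) _ b], of y y]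
        by (simp add: algebra_simps)
    qed
  qed (use g g' hg in auto)
  then show ?thesis using hg'(2) h'g(2) by simp
qed

text \<open>Green's identity by two integrations by parts in each direction; the vanishing of
  \<open>\<psi>\<close> outside a ball leaves no boundary term.\<close>

lemma integral_mult_laplacian:
  fixes h \<psi> :: "'a::euclidean_space \<Rightarrow> real"
  assumes U: "open U" "cball 0 R \<subseteq> U"
    and h: "Ck_on 2 h U" and \<psi>: "Ck_on 2 \<psi> UNIV" "\<And>y. norm y > R \<Longrightarrow> \<psi> y = 0"
  shows "(\<integral>y. h y * laplacian \<psi> y \<partial>lborel) = (\<integral>y. laplacian h y * \<psi> y \<partial>lborel)"
proof -
  have van: "iter_partial bs \<psi> y = 0" if "norm y > R" for y bs
    using iter_partial_vanishes[of "- cball 0 R" \<psi> y bs] \<psi>(2) that by auto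
  have 1: "(\<integral>y. h y * iter_partial [b, b] \<psi> y \<partial>lborel) = (\<integral>y. iter_partial [b, b] h y * \<psi> y \<partial>lborel)"
    and 2: "integrable lborel (\<lambda>y. h y * iter_partial [b, b] \<psi> y)"
    and 3: "integrable lborel (\<lambda>y. iter_partial [b, b] h y * \<psi> y)" if b: "b \<in> Basis" for b
  proof -
    have C: "Ck_on 1 h U" "Ck_on 1 \<psi> UNIV" "Ck_on 1 (partial_deriv b h) U" "Ck_on 1 (partial_deriv b \<psi>) UNIV"
      using Ck_on_mono[OF h] Ck_on_mono[OF \<psi>(1)] Ck_on_partial[of 1 h U b] Ck_on_partial[of 1 \<psi> UNIV b] h \<psi> b
      by (auto simp: numeral_2_eq_2)
    have "(\<integral>y. h y * partial_deriv b (partial_deriv b \<psi>) y \<partial>lborel)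
        = - (\<integral>y. partial_deriv b h y * partial_deriv b \<psi> y \<partial>lborel)"
      by (rule integral_by_parts_partial[OF U C(1,4) _ b]) (use van[of _ "[b]"] in auto)
    also have "\<dots> = (\<integral>y. partial_deriv b (partial_deriv b h) y * \<psi> y \<partial>lborel)"
      by (subst integral_by_parts_partial[OF U C(3,2) \<psi>(2) b]) auto
    finally show "(\<integral>y. h y * iter_partial [b, b] \<psi> y \<partial>lborel) = (\<integral>y. iter_partial [b, b] h y * \<psi> y \<partial>lborel)"
      by simp
    show "integrable lborel (\<lambda>y. h y * iter_partial [b, b] \<psi> y)"
      by (rule mult_extend_zero[OF U])
         (use Ck_on_continuous[OF h, of "[]"] Ck_on_continuous[OF \<psi>(1), of "[b,b]"] van[of _ "[b,b]"] b in auto)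
    show "integrable lborel (\<lambda>y. iter_partial [b, b] h y * \<psi> y)"
      by (rule mult_extend_zero[OF U])
         (use Ck_on_continuous[OF h, of "[b,b]"] Ck_on_continuous[OF \<psi>(1), of "[]"] \<psi>(2) b in auto)
  qed
  show ?thesis
    unfolding laplacian_def sum_distrib_left sum_distrib_right
    using 1 2 3 by (simp del: iter_partial_Cons)
qed

section \<open>Convolution of an integrable function with a compactly supported one\<close>

definition convolve :: "('a::euclidean_space \<Rightarrow> real) \<Rightarrow> ('a \<Rightarrow> real) \<Rightarrow> 'a \<Rightarrow> real"
  where "convolve H g x = (\<integral>z. H z * g (x - z) \<partial>lborel)"

lemma integrable_convolve:
  fixes H g :: "'a::euclidean_space \<Rightarrow> real"
  assumes "integrable lborel H" "continuous_on UNIV g" "\<And>y. \<bar>g y\<bar> \<le> B"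
  shows "integrable lborel (\<lambda>z. H z * g (x - z))"
proof (rule Bochner_Integration.integrable_bound[OF integrable_mult_left[OF assms(1), of B]])
  have "(\<lambda>z. g (x - z)) \<in> borel_measurable borel"
    by (intro borel_measurable_continuous_onI continuous_on_compose2[OF assms(2)] continuous_intros) auto
  then show "(\<lambda>z. H z * g (x - z)) \<in> borel_measurable lborel" using assms(1) by auto
  have "0 \<le> B" using assms(3)[of 0] by linarith
  then show "AE z in lborel. norm (H z * g (x - z)) \<le> norm (H z * B)"
    using assms(3) by (auto simp: abs_mult intro!: mult_left_mono)
qed

lemma continuous_on_convolve:
  fixes H g :: "'a::euclidean_space \<Rightarrow> real"
  assumes "integrable lborel H" "continuous_on UNIV g" "\<And>y. \<bar>g y\<bar> \<le> B"
  shows "continuous_on UNIV (convolve H g)"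
proof (rule continuous_on_sequentiallyI)
  fix u :: "nat \<Rightarrow> 'a" and a assume u: "u \<longlonglongrightarrow> a"
  note int = integrable_convolve[OF assms]
  show "(\<lambda>i. convolve H g (u i)) \<longlonglongrightarrow> convolve H g a"
    unfolding convolve_def
  proof (rule integral_dominated_convergence[where w = "\<lambda>z. norm (H z * B)"])
    show "AE z in lborel. (\<lambda>i. H z * g (u i - z)) \<longlonglongrightarrow> H z * g (a - z)"
      using assms(2) u by (auto intro!: tendsto_intros continuous_on_tendsto_compose[OF assms(2)])
    have "0 \<le> B" using assms(3)[of 0] by linarith
    then show "AE z in lborel. norm (H z * g (u i - z)) \<le> norm (H z * B)" for i
      using assms(3) by (auto simp: abs_mult intro!: mult_left_mono)
  qed (use int assms(1) in auto)
qed

lemma DERIV_convolve: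
  fixes H g :: "'a::euclidean_space \<Rightarrow> real"
  assumes H: "integrable lborel H"
    and g: "continuous_on UNIV g" "\<And>y. \<bar>g y\<bar> \<le> B"
    and g': "continuous_on UNIV g'" "\<And>y. \<bar>g' y\<bar> \<le> B'"
    and deriv: "\<And>y. ((\<lambda>t. g (y + t *\<^sub>R b)) has_real_derivative g' y) (at 0)"
  shows "((\<lambda>t. convolve H g (x + t *\<^sub>R b)) has_real_derivative convolve H g' x) (at 0)"
proof -
  have "((\<lambda>t. \<integral>z. H z * g (x + t *\<^sub>R b - z) \<partial>lborel) has_real_derivative
      (\<integral>z. H z * g' (x + 0 *\<^sub>R b - z) \<partial>lborel)) (at 0)"
  proof (rule DERIV_integral[where D = "\<lambda>z. norm (H z * B')"])
    show "((\<lambda>t. H z * g (x + t *\<^sub>R b - z)) has_real_derivative H z * g' (x + t *\<^sub>R b - z)) (at t)" for t z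
      using has_derivative_line_at[OF deriv, of "x - z" t] 
      by (intro DERIV_cmult) (simp add: algebra_simps)
    have "0 \<le> B'" using g'(2)[of 0] by linarith
    then show "\<bar>H z * g' (x + t *\<^sub>R b - z)\<bar> \<le> norm (H z * B')" for t z
      using g'(2) by (auto simp: abs_mult intro!: mult_left_mono)
    show "(\<lambda>z. H z * g' (x + 0 *\<^sub>R b - z)) \<in> borel_measurable lborel"
      using integrable_convolve[OF H g', of "x + 0 *\<^sub>R b"] by auto
  qed (use integrable_convolve[OF H g] H in auto)
  then show ?thesis by (simp add: convolve_def)
qed

text \<open>All derivatives fall on \<open>g\<close>, so integrability of \<open>H\<close> suffices.
  \<open>H\<close> will be a harmonic function cut off sharply at a ball, hence discontinuous in
  general.\<close>

lemma iter_partial_convolve: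
  fixes H g :: "'a::euclidean_space \<Rightarrow> real"
  assumes H: "integrable lborel H" and g: "Ck_on k g UNIV" "\<And>y. norm y > R \<Longrightarrow> g y = 0"
    and bs: "set bs \<subseteq> Basis" "length bs \<le> k"
  shows "iter_partial bs (convolve H g) = convolve H (iter_partial bs g)"
  using bs
proof (induction bs)
  case (Cons b bs)
  have b: "b \<in> Basis" "set bs \<subseteq> Basis" "length bs < k" "length bs \<le> k" using Cons.prems by auto
  have van: "iter_partial bs g y = 0" if "norm y > R" for y bs
    using iter_partial_vanishes[of "- cball 0 R" g y bs] g(2) that by auto
  note c = Ck_on_continuous[OF g(1) b(2,4)]
  note c' = Ck_on_continuous[OF g(1) Cons.prems]
  obtain B B' where "\<And>y. \<bar>iter_partial bs g y\<bar> \<le> B" "\<And>y. \<bar>iter_partial (b # bs) g y\<bar> \<le> B'"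
    using continuous_vanishing_bounded[OF c van] continuous_vanishing_bounded[OF c' van] by metis
  from DERIV_convolve[OF H c this(1) c' this(2) Ck_on_DERIV[OF g(1) b(2,3,1)]]
  have "partial_deriv b (convolve H (iter_partial bs g)) x = convolve H (iter_partial (b # bs) g) x" for x
    by (intro partial_deriv_eqI) auto
  then show ?case using Cons b by auto
qed simp

lemma Ck_on_convolve:
  fixes H g :: "'a::euclidean_space \<Rightarrow> real"
  assumes H: "integrable lborel H" and g: "Ck_on k g UNIV" "\<And>y. norm y > R \<Longrightarrow> g y = 0"
  shows "Ck_on k (convolve H g) UNIV"
proof (rule Ck_onI)
  have van: "iter_partial bs g y = 0" if "norm y > R" for y bs
    using iter_partial_vanishes[of "- cball 0 R" g y bs] g(2) that by auto
  fix bs :: "'a list" assume bs: "set bs \<subseteq> Basis" "length bs \<le> k"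
  note c = Ck_on_continuous[OF g(1) bs]
  obtain B where B: "\<And>y. \<bar>iter_partial bs g y\<bar> \<le> B"
    using continuous_vanishing_bounded[OF c van] by metis
  show "continuous_on UNIV (iter_partial bs (convolve H g))"
    using continuous_on_convolve[OF H c B] iter_partial_convolve[OF H g(1) _ bs] g(2) by metis
next
  have van: "iter_partial bs g y = 0" if "norm y > R" for y bs
    using iter_partial_vanishes[of "- cball 0 R" g y bs] g(2) that by auto
  fix bs :: "'a list" and b x :: 'a assume bs: "set bs \<subseteq> Basis" "length bs < k" "b \<in> Basis"
  then have bs': "length bs \<le> k" "set (b # bs) \<subseteq> Basis" "length (b # bs) \<le> k" by auto
  note c = Ck_on_continuous[OF g(1) bs(1) bs'(1)]
  note c' = Ck_on_continuous[OF g(1) bs'(2,3)]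
  obtain B B' where "\<And>y. \<bar>iter_partial bs g y\<bar> \<le> B" "\<And>y. \<bar>iter_partial (b # bs) g y\<bar> \<le> B'"
    using continuous_vanishing_bounded[OF c van] continuous_vanishing_bounded[OF c' van] by metis
  note D = DERIV_convolve[OF H c this(1) c' this(2) Ck_on_DERIV[OF g(1) bs], OF UNIV_I]
  have eq: "iter_partial bs (convolve H g) = convolve H (iter_partial bs g)"
    by (rule iter_partial_convolve[OF H g(1) _ bs(1) bs'(1)]) (rule g(2))
  show "\<exists>D. ((\<lambda>t. iter_partial bs (convolve H g) (x + t *\<^sub>R b)) has_real_derivative D) (at 0)"
    unfolding eq by (rule exI) (rule D)
qed

section \<open>The truncated fundamental solution and the mean value property\<close>


text \<open>Normalised so that the first derivative in t is t^(-n/2); both formulas of order 0 are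
  primitives of it, the logarithm being the one for exponent -1. With t = |x|^2 this is a multiple
  of the usual fundamental solution of the Laplacian.\<close>

fun fund :: "nat \<Rightarrow> nat \<Rightarrow> real \<Rightarrow> real" where
  "fund n 0 t = (if n = 2 then ln t else t powr (1 - n / 2) / (1 - n / 2))"
| "fund n (Suc j) t = (- 1) ^ j * pochhammer (n / 2) j * t powr (- (n / 2) - j)"

lemma DERIV_fund:
  assumes "t > 0"
  shows "(fund n j has_real_derivative fund n (Suc j) t) (at t)"
proof (cases j)
  case 0
  show ?thesis
  proof (cases "n = 2")
    case True
    have "fund n 0 = ln" using True by (auto simp: fun_eq_iff)
    then show ?thesis
      using 0 True DERIV_ln[OF assms] assms by (simp add: powr_minus)
  next
    case False
    then have ne: "1 - real n / 2 \<noteq> 0" by (auto simp: field_simps)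
    have eq: "fund n 0 = (\<lambda>t. t powr (1 - n / 2) / (1 - n / 2))" using False by (auto simp: fun_eq_iff)
    have "((\<lambda>t. t powr (1 - n / 2) / (1 - n / 2)) has_real_derivative
        (1 - n / 2) * t powr (1 - n / 2 - 1) / (1 - n / 2)) (at t)"
      by (intro DERIV_cdivide has_real_derivative_powr assms)
    then show ?thesis using 0 eq ne by simp
  qed
next
  case (Suc i)
  have "fund n (Suc i) = (\<lambda>t. (- 1) ^ i * pochhammer (n / 2) i * t powr (- (n / 2) - i))" by auto
  moreover have "((\<lambda>t. (- 1) ^ i * pochhammer (n / 2) i * t powr (- (n / 2) - i)) has_real_derivative
      (- 1) ^ i * pochhammer (n / 2) i * ((- (n / 2) - i) * t powr (- (n / 2) - i - 1))) (at t)"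
    by (intro DERIV_cmult has_real_derivative_powr assms)
  moreover have "(- 1) ^ i * pochhammer (n / 2) i * ((- (real n / 2) - i) * t powr (- (n / 2) - i - 1)) = fund n (Suc j) t"
    by (simp add: Suc pochhammer_Suc algebra_simps)
  ultimately show ?thesis using Suc by simp
qed

text \<open>The radial Laplace equation 2 n f' + 4 t f'' = 0, differentiated j times.\<close>

lemma fund_recurrence:
  assumes "t > 0"
  shows "4 * t * fund n (Suc (Suc j)) t + (2 * n + 4 * j) * fund n (Suc j) t = 0"
proof -
  have "t * t powr (- (n / 2) - Suc j) = t powr (- (n / 2) - j)"
    using assms powr_add[of t 1 "- (n / 2) - Suc j"] by simp
  moreover have "fund n (Suc (Suc j)) t = (- (n / 2 + j) * ((- 1) ^ j * pochhammer (n / 2) j)) * t powr (- (n / 2) - Suc j)"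
    by (simp add: pochhammer_Suc algebra_simps)
  then have "t * fund n (Suc (Suc j)) t = (- (n / 2 + j) * ((- 1) ^ j * pochhammer (n / 2) j)) * (t * t powr (- (n / 2) - Suc j))"
    by (simp only: mult_ac)
  ultimately have "t * fund n (Suc (Suc j)) t = - (n / 2 + j) * fund n (Suc j) t"
    by (simp only: fund.simps mult.assoc)
  then show ?thesis by (simp add: algebra_simps)
qed

definition taylor :: "(nat \<Rightarrow> real) \<Rightarrow> nat \<Rightarrow> real \<Rightarrow> real" where
  "taylor c M w = (\<Sum>i\<le>M. c i * w ^ i / fact i)"

lemma taylor_0 [simp]: "taylor c M 0 = c 0"
  by (simp add: taylor_def sum.atMost_shift)

lemma DERIV_taylor: "(taylor c (Suc M) has_real_derivative taylor (\<lambda>i. c (Suc i)) M w) (at w)"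
proof -
  have "((\<lambda>w. c 0 + (\<Sum>i\<le>M. c (Suc i) * w ^ Suc i / fact (Suc i))) has_real_derivative
      (\<Sum>i\<le>M. c (Suc i) * (real (Suc i) * w ^ i) / fact (Suc i))) (at w)"
    by (auto intro!: derivative_eq_intros sum.cong simp del: power_Suc fact_Suc)
  moreover have "taylor c (Suc M) = (\<lambda>w. c 0 + (\<Sum>i\<le>M. c (Suc i) * w ^ Suc i / fact (Suc i)))"
    by (simp add: taylor_def fun_eq_iff sum.atMost_Suc_shift del: power_Suc fact_Suc sum.atMost_Suc)
  moreover have "c (Suc i) * (real (Suc i) * w ^ i) / fact (Suc i) = c (Suc i) * w ^ i / fact i" for i
    by (simp del: of_nat_Suc)
  ultimately show ?thesis by (simp add: taylor_def)
qed

text \<open>The coefficient of w^i on the left is ((2 n + 4 i) d_i + 4 \<sigma> d_(i+1)) / i!. It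
  vanishes by hypothesis for i <= p; for i = p + 1 the term with \<sigma> is missing because the
  second polynomial stops at degree p.\<close>

lemma taylor_radial_laplacian:
  assumes "\<And>j. 4 * \<sigma> * d (Suc j) + (2 * n + 4 * real j) * d j = 0"
  shows "2 * n * taylor d (Suc p) w + 4 * (\<sigma> + w) * taylor (\<lambda>i. d (Suc i)) p w
      = (2 * n + 4 * real (Suc p)) * d (Suc p) * w ^ Suc p / fact (Suc p)"
proof (induction p)
  case 0
  have "d 0 * (2 * n) = - 4 * \<sigma> * d 1" using assms[of 0] by (simp add: algebra_simps)
  then show ?case by (simp add: taylor_def algebra_simps)
next
  case (Suc p)
  let ?q = "w ^ Suc p / fact (Suc p)"
  have q: "w ^ Suc (Suc p) / fact (Suc (Suc p)) * real (Suc (Suc p)) = w * ?q"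
    unfolding power_Suc[of w "Suc p"] fact_Suc[of "Suc p"] by (simp del: of_nat_Suc fact_Suc power_Suc)
  have r: "4 * \<sigma> * d (Suc (Suc p)) = - ((2 * n + 4 * real (Suc p)) * d (Suc p))"
    using assms[of "Suc p"] by linarith
  have "2 * n * taylor d (Suc (Suc p)) w + 4 * (\<sigma> + w) * taylor (\<lambda>i. d (Suc i)) (Suc p) w
    = (2 * n * taylor d (Suc p) w + 4 * (\<sigma> + w) * taylor (\<lambda>i. d (Suc i)) p w)
      + 2 * n * (d (Suc (Suc p)) * (w ^ Suc (Suc p) / fact (Suc (Suc p)))) 
      + (4 * \<sigma> * d (Suc (Suc p))) * ?q + 4 * d (Suc (Suc p)) * (w * ?q)"
    by (simp add: taylor_def algebra_simps add_divide_distrib del: power_Suc fact_Suc)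
  also have "\<dots> = (2 * n + 4 * real (Suc (Suc p))) * d (Suc (Suc p)) * (w ^ Suc (Suc p) / fact (Suc (Suc p)))"
    unfolding Suc.IH r q[symmetric] by (simp add: algebra_simps add_divide_distrib del: power_Suc fact_Suc)
  finally show ?case by simp
qed

text \<open>The argument \<open>j\<close> of \<open>fund\<close> and \<open>trunc_fund\<close> is the order of the derivative with respect to
  the variable \<open>t = x \<bullet> x\<close>.\<close>

definition trunc_fund :: "nat \<Rightarrow> nat \<Rightarrow> real \<Rightarrow> nat \<Rightarrow> real \<Rightarrow> real" where
  "trunc_fund n M \<sigma> j t = (if t < \<sigma> then taylor (\<lambda>i. fund n (i + j) \<sigma>) (M - j) (t - \<sigma>) else fund n j t)"

lemma DERIV_trunc_fund:
  assumes "\<sigma> > 0" "j < M"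
  shows "(trunc_fund n M \<sigma> j has_real_derivative trunc_fund n M \<sigma> (Suc j) t) (at t)"
proof -
  let ?T = "\<lambda>t. taylor (\<lambda>i. fund n (i + j) \<sigma>) (M - j) (t - \<sigma>)"
  have T: "(?T has_real_derivative taylor (\<lambda>i. fund n (i + Suc j) \<sigma>) (M - Suc j) (t - \<sigma>)) (at t)" for t
  proof -
    have "M - j = Suc (M - Suc j)" using assms(2) by simp
    then show ?thesis
      using DERIV_taylor[of "\<lambda>i. fund n (i + j) \<sigma>" "M - Suc j" "t + - \<sigma>"] unfolding DERIV_shift
      by (simp del: fund.simps)
  qed
  consider "t < \<sigma>" | "t > \<sigma>" | "t = \<sigma>" by linarith
  then show ?thesis
  proof cases
    case 1
    have "(trunc_fund n M \<sigma> j has_real_derivative trunc_fund n M \<sigma> (Suc j) t) (at t) \<longleftrightarrow>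
        (?T has_real_derivative trunc_fund n M \<sigma> (Suc j) t) (at t)"
      by (rule DERIV_cong_ev[OF refl _ refl])
         (use eventually_nhds_in_open[of "{..<\<sigma>}" t] 1 in \<open>auto simp: trunc_fund_def elim!: eventually_mono\<close>)
    then show ?thesis using T[of t] 1 by (simp add: trunc_fund_def)
  next
    case 2
    have "(trunc_fund n M \<sigma> j has_real_derivative trunc_fund n M \<sigma> (Suc j) t) (at t) \<longleftrightarrow>
        (fund n j has_real_derivative trunc_fund n M \<sigma> (Suc j) t) (at t)"
      by (rule DERIV_cong_ev[OF refl _ refl])
         (use eventually_nhds_in_open[of "{\<sigma><..}" t] 2 in \<open>auto simp: trunc_fund_def elim!: eventually_mono\<close>)
    then show ?thesis using DERIV_fund[of t n j] 2 assms by (simp add: trunc_fund_def del: fund.simps)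
  next
    \<comment> \<open>At the gluing point the one-sided derivatives agree: for j < M the Taylor
      polynomial has the slope of \<open>fund n j\<close> there.\<close>
    case 3
    let ?f = "trunc_fund n M \<sigma> j"
    have "(?T has_real_derivative fund n (Suc j) \<sigma>) (at \<sigma>)"
      using T[of \<sigma>] by (simp del: fund.simps)
    then have "(?T has_real_derivative fund n (Suc j) \<sigma>) (at \<sigma> within {..\<sigma>})"
      by (rule has_field_derivative_at_within)
    then have L: "(?f has_real_derivative fund n (Suc j) \<sigma>) (at \<sigma> within {..\<sigma>})"
      by (rule has_field_derivative_transform_within[OF _ zero_less_one]) (auto simp: trunc_fund_def simp del: fund.simps)
    have "(fund n j has_real_derivative fund n (Suc j) \<sigma>) (at \<sigma> within {\<sigma>..})"
      by (rule has_field_derivative_at_within[OF DERIV_fund[OF assms(1)]])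
    then have R: "(?f has_real_derivative fund n (Suc j) \<sigma>) (at \<sigma> within {\<sigma>..})"
      by (rule has_field_derivative_transform_within[OF _ zero_less_one]) (auto simp: trunc_fund_def)
    have "(?f has_real_derivative fund n (Suc j) \<sigma>) (at \<sigma> within ({..\<sigma>} \<union> {\<sigma>..}))"
      using L R unfolding has_field_derivative_iff by (rule Lim_Un)
    moreover have "{..\<sigma>} \<union> {\<sigma>..} = UNIV" by auto
    ultimately show ?thesis using 3 by (simp add: trunc_fund_def del: fund.simps)
  qed
qed

lemma isCont_trunc_fund:
  assumes "\<sigma> > 0" shows "isCont (trunc_fund n M \<sigma> M) t"
proof -
  \<comment> \<open>At top order the Taylor polynomial is the constant
    \<open>fund n M \<sigma>\<close>, so the function is \<open>fund n M\<close> frozen below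
    \<open>\<sigma>\<close>.\<close>
  have eq: "trunc_fund n M \<sigma> M = (\<lambda>t. fund n M (max t \<sigma>))"
    by (auto simp: trunc_fund_def taylor_def fun_eq_iff max_def simp del: fund.simps)
  have "isCont (fund n M) (max t \<sigma>)"
    using DERIV_isCont[OF DERIV_fund[of "max t \<sigma>"]] assms by simp
  then show ?thesis unfolding eq
    by (rule isCont_o2[rotated]) (auto intro!: continuous_intros)
qed

text \<open>The closed form of \<open>2 * n * f' t + 4 * t * f'' t\<close> for \<open>f = trunc_fund n (p + 2) \<sigma> 0\<close>: the
  recurrence of \<open>fund\<close> makes all terms of the Taylor polynomial but the last one cancel.\<close>

definition bump :: "nat \<Rightarrow> nat \<Rightarrow> real \<Rightarrow> real \<Rightarrow> real" where
  "bump n p \<sigma> t = (if t < \<sigma> then (2 * n + 4 * Suc p) * fund n (p + 2) \<sigma> * (t - \<sigma>) ^ Suc p / fact (Suc p) else 0)"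

text \<open>The sign (-1)^(p+1) carried by the derivative of order p + 2 cancels the sign of (t -
  \<sigma>)^(p+1) for t < \<sigma>, whatever the parity of p.\<close>

lemma bump_nonneg: "0 \<le> bump n p \<sigma> t"
proof -
  have "fund n (p + 2) \<sigma> * (t - \<sigma>) ^ Suc p = pochhammer (n / 2) (Suc p) * \<sigma> powr (- (n / 2) - Suc p) * (\<sigma> - t) ^ Suc p"
    using power_mult_distrib[of "-1" "t - \<sigma>" "Suc p"] by simp
  also have "\<dots> \<ge> 0" if "t < \<sigma>"
  proof -
    have "0 \<le> pochhammer (real n / 2) (Suc p)"
      unfolding pochhammer_prod by (rule prod_nonneg) auto
    then show ?thesis using that by (intro mult_nonneg_nonneg) auto
  qed
  finally have *: "fund n (p + 2) \<sigma> * (t - \<sigma>) ^ Suc p \<ge> 0" if "t < \<sigma>" using that .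
  have "(2 * n + 4 * Suc p) * (fund n (p + 2) \<sigma> * (t - \<sigma>) ^ Suc p) / fact (Suc p) \<ge> 0" if "t < \<sigma>"
    by (intro divide_nonneg_nonneg mult_nonneg_nonneg *[OF that]) auto
  then show ?thesis by (auto simp: bump_def mult.assoc simp del: fund.simps)
qed

lemma bump_1: "n > 0 \<Longrightarrow> \<exists>C>0. \<forall>t<1. bump n p 1 t = C * (1 - t) ^ Suc p"
proof -
  assume "n > 0"
  have "(t - 1) ^ Suc p = (- 1) ^ Suc p * (1 - t) ^ Suc p" for t :: real
    using power_mult_distrib[of "-1" "1 - t" "Suc p"] by simp
  then have eq: "bump n p 1 t = ((2 * n + 4 * Suc p) * pochhammer (n / 2) (Suc p) / fact (Suc p)) * (1 - t) ^ Suc p"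
    if "t < 1" for t
    using that by (simp add: bump_def flip: power_add mult.assoc)
  have "(2 * real n + 4 * Suc p) * pochhammer (n / 2) (Suc p) / fact (Suc p) > 0"
    using \<open>n > 0\<close> by (intro divide_pos_pos mult_pos_pos pochhammer_pos) auto
  then show ?thesis using eq by auto
qed

section \<open>The truncated solution and the mollifier as functions on space\<close>

text \<open>Gluing at order p + 2 gives class C^(p+2), which leaves class C^p for the
  Laplacian.\<close>

definition trunc_sol :: "nat \<Rightarrow> real \<Rightarrow> 'a::euclidean_space \<Rightarrow> real" where
  "trunc_sol p \<sigma> x = trunc_fund DIM('a) (p + 2) \<sigma> 0 (x \<bullet> x)"

lemma Ck_on_trunc_sol: 
  assumes "\<sigma> > 0" shows "Ck_on (p + 2) (trunc_sol p \<sigma> :: 'a::euclidean_space \<Rightarrow> real) UNIV"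
  unfolding trunc_sol_def
  by (rule Ck_on_radial[where \<phi> = "trunc_fund DIM('a) (p + 2) \<sigma>"])
     (use DERIV_trunc_fund[OF assms] isCont_trunc_fund[OF assms] in auto)

lemma laplacian_trunc_sol:
  fixes x :: "'a::euclidean_space"
  assumes "\<sigma> > 0"
  shows "laplacian (trunc_sol p \<sigma>) x = bump DIM('a) p \<sigma> (x \<bullet> x)"
proof -
  let ?n = "DIM('a)" and ?t = "x \<bullet> x"
  let ?f = "trunc_fund ?n (p + 2) \<sigma>"
  have "laplacian (\<lambda>x. ?f 0 (x \<bullet> x)) x = 2 * DIM('a) * ?f (Suc 0) ?t + 4 * ?t * ?f (Suc (Suc 0)) ?t"
    by (rule laplacian_radial[OF open_UNIV UNIV_I]) (rule DERIV_trunc_fund[OF assms], simp)+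
  also have "\<dots> = bump ?n p \<sigma> ?t"
  proof (cases "?t < \<sigma>")
    case True
    have "2 * real ?n * taylor (\<lambda>i. fund ?n (Suc i) \<sigma>) (Suc p) (?t - \<sigma>)
        + 4 * (\<sigma> + (?t - \<sigma>)) * taylor (\<lambda>i. fund ?n (Suc (Suc i)) \<sigma>) p (?t - \<sigma>)
        = (2 * real ?n + 4 * real (Suc p)) * fund ?n (Suc (Suc p)) \<sigma> * (?t - \<sigma>) ^ Suc p / fact (Suc p)"
      by (rule taylor_radial_laplacian) (rule fund_recurrence[OF assms])
    then show ?thesis using True by (simp add: trunc_fund_def bump_def del: fund.simps)
  next
    case False
    then have "?t > 0" using assms by linarith
    then have "4 * ?t * fund ?n (Suc (Suc 0)) ?t + (2 * real ?n + 4 * real 0) * fund ?n (Suc 0) ?t = 0"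
      by (rule fund_recurrence)
    then show ?thesis using False
      by (simp add: trunc_fund_def bump_def algebra_simps del: fund.simps)
  qed
  finally show ?thesis by (simp add: trunc_sol_def[abs_def])
qed

text \<open>The parameter \<open>\<sigma>\<close> is the square of the support radius, hence the
  arguments \<open>s^2\<close> below. The kernel is not normalised; its mass is carried along as a
  constant.\<close>

definition mollifier :: "nat \<Rightarrow> real \<Rightarrow> 'a::euclidean_space \<Rightarrow> real" where
  "mollifier p \<sigma> = laplacian (trunc_sol p \<sigma>)"

lemma mollifier_eq: "\<sigma> > 0 \<Longrightarrow> mollifier p \<sigma> (x :: 'a::euclidean_space) = bump DIM('a) p \<sigma> (x \<bullet> x)"
  by (simp add: mollifier_def laplacian_trunc_sol)

lemma Ck_on_mollifier:
  assumes "\<sigma> > 0" shows "Ck_on p (mollifier p \<sigma> :: 'a::euclidean_space \<Rightarrow> real) UNIV"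
proof -
  have "Ck_on p (partial_deriv b (partial_deriv b (trunc_sol p \<sigma>))) (UNIV :: 'a set)" if "b \<in> Basis" for b
    using Ck_on_partial[OF Ck_on_partial[OF _ that] that, of p "trunc_sol p \<sigma>" UNIV] Ck_on_trunc_sol[OF assms, of p] by simp
  then have "Ck_on p (\<lambda>x. \<Sum>b\<in>Basis. 1 * partial_deriv b (partial_deriv b (trunc_sol p \<sigma>)) x) (UNIV :: 'a set)"
    by (intro Ck_on_sum open_UNIV)
  moreover have "mollifier p \<sigma> = (\<lambda>x::'a. \<Sum>b\<in>Basis. 1 * partial_deriv b (partial_deriv b (trunc_sol p \<sigma>)) x)"
    by (simp add: mollifier_def laplacian_def fun_eq_iff)
  ultimately show ?thesis by simp
qed

lemma mollifier_nonneg: "\<sigma> > 0 \<Longrightarrow> 0 \<le> mollifier p \<sigma> (x :: 'a::euclidean_space)"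
  by (simp add: mollifier_eq bump_nonneg)

lemma mollifier_vanishes:
  fixes x :: "'a::euclidean_space"
  assumes "0 < s" "s < norm x" shows "mollifier p (s^2) x = 0"
proof -
  have "s^2 < (norm x)^2" using assms by (intro power_strict_mono) auto
  then show ?thesis using assms by (simp add: mollifier_eq bump_def power2_norm_eq_inner)
qed

lemma mollifier_minus: "\<sigma> > 0 \<Longrightarrow> mollifier p \<sigma> (- x :: 'a::euclidean_space) = mollifier p \<sigma> x"
  by (simp add: mollifier_eq)

lemma integrable_mollifier: "0 < s \<Longrightarrow> integrable lborel (mollifier p (s^2) :: 'a::euclidean_space \<Rightarrow> real)"
  by (rule continuous_vanishing_integrable[OF Ck_on_continuous0[OF Ck_on_mollifier]]) (auto intro: mollifier_vanishes)

lemma harmonic_on_const: "open U \<Longrightarrow> harmonic_on (\<lambda>_. c) U"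
  by (simp add: harmonic_on_def laplacian_def iter_partial_const del: iter_partial_Cons)

text \<open>The two mollifiers differ by the Laplacian of the compactly supported difference of two
  truncated solutions.\<close>

lemma integral_harmonic_mollifier_scale:
  fixes h :: "'a::euclidean_space \<Rightarrow> real"
  assumes h: "harmonic_on h U" "cball 0 1 \<subseteq> U" and s: "0 < s" "s \<le> 1"
  shows "(\<integral>y. h y * mollifier p (s^2) y \<partial>lborel) = (\<integral>y. h y * mollifier p (1^2) y \<partial>lborel)"
proof -
  have U: "open U" "Ck_on 2 h U" "\<And>x. x \<in> U \<Longrightarrow> laplacian h x = 0" using h by (auto simp: harmonic_on_def)
  have s2: "s^2 > 0" "s^2 \<le> 1" using s by (auto simp: power_le_one)
  define \<psi> where "\<psi> = (\<lambda>y::'a. 1 * trunc_sol p (s^2) y + (-1) * trunc_sol p (1^2) y)"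
  have C: "Ck_on 2 (trunc_sol p (s^2) :: 'a \<Rightarrow> real) UNIV" "Ck_on 2 (trunc_sol p (1^2) :: 'a \<Rightarrow> real) UNIV"
    by (rule Ck_on_mono[OF Ck_on_trunc_sol]; use s in simp)+
  \<comment> \<open>Outside the unit ball both truncations equal the same fundamental
    solution.\<close>
  have van: "\<psi> y = 0" if "norm y > 1" for y
  proof -
    have "1^2 < (norm y)^2" using that by (intro power_strict_mono) auto
    then show ?thesis using s2 by (simp add: \<psi>_def trunc_sol_def trunc_fund_def power2_norm_eq_inner)
  qed
  have lap: "laplacian \<psi> y = mollifier p (s^2) y - mollifier p (1^2) y" for y
    unfolding laplacian_def \<psi>_def mollifier_def sum_subtractf[symmetric]
    by (rule sum.cong[OF refl], subst iter_partial_linear[OF open_UNIV C]) auto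
  have int: "integrable lborel (\<lambda>y. h y * mollifier p (r^2) y)" if "0 < r" "r \<le> 1" for r
    by (rule mult_extend_zero[OF U(1) h(2) Ck_on_continuous0[OF U(2)] Ck_on_continuous0[OF Ck_on_mollifier]])
       (use that in \<open>auto intro!: mollifier_vanishes\<close>)
  have "(\<integral>y. h y * laplacian \<psi> y \<partial>lborel) = (\<integral>y. laplacian h y * \<psi> y \<partial>lborel)"
    by (rule integral_mult_laplacian[OF U(1) h(2) U(2) _ van]) (use Ck_on_linear[OF open_UNIV C, of 1 "-1"] \<psi>_def in auto)
  also have "(\<lambda>y. laplacian h y * \<psi> y) = (\<lambda>y. 0)"
    using U(3) h(2) van by (force simp: fun_eq_iff)
  finally have "(\<integral>y. h y * mollifier p (s^2) y - h y * mollifier p (1^2) y \<partial>lborel) = 0"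
    unfolding lap by (simp add: right_diff_distrib)
  then show ?thesis using int[of s] int[of 1] s by simp
qed

text \<open>The dimension enters through the type only, hence the \<open>itself\<close>
  argument.\<close>

definition mollifier_mass :: "nat \<Rightarrow> 'a::euclidean_space itself \<Rightarrow> real" where
  "mollifier_mass p _ = (\<integral>y. mollifier p (1^2) (y::'a) \<partial>lborel)"

lemma mollifier_mass_pos: "mollifier_mass p TYPE('a::euclidean_space) > 0"
proof -
  obtain C where C: "C > 0" "\<And>t. t < 1 \<Longrightarrow> bump DIM('a) p 1 t = C * (1 - t) ^ Suc p"
    using bump_1[of "DIM('a)" p] by auto
  \<comment> \<open>On the ball of radius 1/2 the factor 1 - y . y is at least 3/4; the cruder base
    1/2 already gives a positive lower bound.\<close>
  let ?B = "cball (0::'a) (1/2)" and ?\<kappa> = "C * (1/2) ^ Suc p"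
  have *: "?\<kappa> * indicator ?B y \<le> mollifier p (1^2) y" for y :: 'a
  proof (cases "y \<in> ?B")
    case True
    have "(norm y)^2 \<le> (1/2)^2" using True by (intro power_mono) auto
    then have "y \<bullet> y \<le> 1/4" by (simp add: dot_square_norm power_divide)
    then have "C * (1/2) ^ Suc p \<le> C * (1 - y \<bullet> y) ^ Suc p"
      using C(1) by (intro mult_left_mono power_mono) auto
    then show ?thesis using True C(2)[of "y \<bullet> y"] \<open>y \<bullet> y \<le> 1/4\<close> by (simp add: mollifier_eq)
  qed (use mollifier_nonneg[of "1^2" p y] in auto)
  have fin: "emeasure lborel ?B < \<infinity>" by (rule emeasure_compact_finite) simp
  have "0 < ?\<kappa> * measure lborel ?B"
    using C(1) content_cball_pos[of "1/2" "0::'a"] by (intro mult_pos_pos) auto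
  also have "\<dots> = (\<integral>y. ?\<kappa> * indicator ?B y \<partial>lborel)" by simp
  also have "\<dots> \<le> mollifier_mass p TYPE('a)"
    unfolding mollifier_mass_def using fin integrable_mollifier[of 1 p, where 'a = 'a]
    by (intro integral_mono *) auto
  finally show ?thesis .
qed

text \<open>The constant function 1 is harmonic, so its scale invariance shows, without a change of
  variables, that the mass is independent of the radius.\<close>

lemma integral_mollifier:
  assumes "0 < s" "s \<le> 1"
  shows "(\<integral>y. mollifier p (s^2) (y::'a::euclidean_space) \<partial>lborel) = mollifier_mass p TYPE('a)"
  using integral_harmonic_mollifier_scale[OF harmonic_on_const[OF open_UNIV, of 1], of s p, where 'a = 'a] assms
  by (simp add: mollifier_mass_def)

section \<open>Mean value property and smoothness of harmonic functions\<close>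

text \<open>The weighted integral does not depend on the radius s of the mollifier; as s shrinks,
  continuity of \<open>h\<close> at 0 identifies it as the mass times h(0).\<close>

lemma harmonic_mean_value_0:
  fixes h :: "'a::euclidean_space \<Rightarrow> real"
  assumes h: "harmonic_on h U" "cball 0 1 \<subseteq> U"
  shows "(\<integral>y. h y * mollifier p (1^2) y \<partial>lborel) = mollifier_mass p TYPE('a) * h 0"
proof -
  let ?c = "mollifier_mass p TYPE('a)" and ?I = "\<integral>y. h y * mollifier p (1^2) y \<partial>lborel"
  have U: "open U" "Ck_on 2 h U" using h by (auto simp: harmonic_on_def)
  have "\<bar>?I - ?c * h 0\<bar> \<le> \<epsilon> * ?c" if "\<epsilon> > 0" for \<epsilon>
  proof -
    have "0 \<in> U" by (rule subsetD[OF h(2)]) simp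
    then have "isCont h 0"
      using Ck_on_continuous0[OF U(2)] U(1) h(2) by (auto simp: continuous_on_eq_continuous_at)
    then obtain d where d: "d > 0" "\<And>y. dist y 0 < d \<Longrightarrow> dist (h y) (h 0) < \<epsilon>"
      using \<open>\<epsilon> > 0\<close> unfolding continuous_at_eps_delta by metis
    define s where "s = min 1 (d / 2)"
    have s: "0 < s" "s \<le> 1" "s < d" using d(1) by (auto simp: s_def)
    have int: "integrable lborel (\<lambda>y. h y * mollifier p (s^2) y)"
      by (rule mult_extend_zero[OF U(1) h(2) Ck_on_continuous0[OF U(2)] Ck_on_continuous0[OF Ck_on_mollifier]])
         (use s in \<open>auto intro!: mollifier_vanishes\<close>)
    note ik = integrable_mollifier[OF s(1), of p, where 'a = 'a]
    have "?I - ?c * h 0 = (\<integral>y. h y * mollifier p (s^2) y \<partial>lborel) - (\<integral>y. h 0 * mollifier p (s^2) (y::'a) \<partial>lborel)"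
      using integral_harmonic_mollifier_scale[OF h s(1,2), of p] integral_mollifier[OF s(1,2), of p, where 'a = 'a] by simp
    also have "\<dots> = (\<integral>y. h y * mollifier p (s^2) y - h 0 * mollifier p (s^2) y \<partial>lborel)"
      using int ik by simp
    also have "\<bar>\<dots>\<bar> \<le> (\<integral>y. \<epsilon> * mollifier p (s^2) (y::'a) \<partial>lborel)"
    proof (rule order_trans[OF integral_abs_bound integral_mono])
      show "\<bar>h y * mollifier p (s^2) y - h 0 * mollifier p (s^2) y\<bar> \<le> \<epsilon> * mollifier p (s^2) y" for y
      proof (cases "norm y \<le> s")
        case True
        then have "\<bar>h y - h 0\<bar> \<le> \<epsilon>" using d(2)[of y] s by (simp add: dist_real_def)
        then have "\<bar>h y - h 0\<bar> * mollifier p (s^2) y \<le> \<epsilon> * mollifier p (s^2) y"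
          using mollifier_nonneg[of "s^2" p y] s by (intro mult_right_mono) auto
        then show ?thesis
          using mollifier_nonneg[of "s^2" p y] s(1) by (simp add: abs_mult flip: left_diff_distrib)
      qed (use mollifier_vanishes[OF s(1), of y p] in auto)
    qed (use int ik in auto)
    also have "\<dots> = \<epsilon> * ?c" using integral_mollifier[OF s(1,2), of p, where 'a = 'a] by simp
    finally show ?thesis .
  qed
  note bound = this
  have "\<bar>?I - ?c * h 0\<bar> \<le> 0"
  proof (rule field_le_epsilon)
    fix e :: real assume "e > 0"
    then show "\<bar>?I - ?c * h 0\<bar> \<le> 0 + e"
      using bound[of "e / ?c"] mollifier_mass_pos[of p, where 'a = 'a] by simp
  qed
  then show ?thesis by simp
qed

lemma harmonic_on_affine:
  fixes h :: "'a::euclidean_space \<Rightarrow> real"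
  assumes "harmonic_on h V" "open U" "\<And>x. x \<in> U \<Longrightarrow> a + s *\<^sub>R x \<in> V"
  shows "harmonic_on (\<lambda>x. h (a + s *\<^sub>R x)) U"
proof -
  have V: "open V" "Ck_on 2 h V" "\<And>x. x \<in> V \<Longrightarrow> laplacian h x = 0"
    using assms(1) by (auto simp: harmonic_on_def)
  have "laplacian (\<lambda>x. h (a + s *\<^sub>R x)) x = s^2 * laplacian h (a + s *\<^sub>R x)" if "x \<in> U" for x
    unfolding laplacian_def sum_distrib_left
    using iter_partial_affine[OF V(1,2) _ _ assms(3)[OF that]] by (intro sum.cong refl) (simp add: power2_eq_square del: iter_partial_Cons)
  then show ?thesis
    unfolding harmonic_on_def using assms Ck_on_affine[OF V(1,2) assms(2,3)] V(3) by simp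
qed

text \<open>For x in the unit ball a mollifier of radius 1 reads \<open>h\<close> inside the ball of
  radius 2 only, so the sharp cutoff \<open>H\<close> does not affect the mean value at x.\<close>

lemma harmonic_eq_convolve:
  fixes h :: "'a::euclidean_space \<Rightarrow> real"
  assumes h: "harmonic_on h U" "cball 0 2 \<subseteq> U" and x: "x \<in> ball 0 1"
  defines "H \<equiv> \<lambda>z. indicator (cball 0 2) z *\<^sub>R h z"
  shows "convolve H (mollifier p (1^2)) x = mollifier_mass p TYPE('a) * h x"
proof -
  have U: "open U" "Ck_on 2 h U" using h by (auto simp: harmonic_on_def)
  have H: "integrable lborel H"
    unfolding H_def using continuous_on_subset[OF Ck_on_continuous0[OF U(2)] h(2)]
    by (intro borel_integrable_compact) auto
  \<comment> \<open>The scalar 1 is kept so that \<open>harmonic_on_affine\<close> matches.\<close>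
  let ?h = "\<lambda>y. h (x + 1 *\<^sub>R y)" and ?U = "(\<lambda>y. x + 1 *\<^sub>R y) -` U"
  have "open ?U" by (intro open_vimage U continuous_intros)
  then have hh: "harmonic_on ?h ?U" by (rule harmonic_on_affine[OF h(1)]) auto
  have sub: "x + y \<in> cball 0 2" if "norm y \<le> 1" for y
    using x norm_triangle_ineq[of x y] that by auto
  then have "cball 0 1 \<subseteq> ?U" using h(2) by (auto simp: subset_iff)
  from harmonic_mean_value_0[OF hh this, of p]
  have "mollifier_mass p TYPE('a) * h x = (\<integral>y. h (x + y) * mollifier p (1^2) y \<partial>lborel)" by simp
  also have "\<dots> = (\<integral>y. H (x + y) * mollifier p (1^2) (x - (x + y)) \<partial>lborel)"
  proof (intro Bochner_Integration.integral_cong refl)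
    fix y show "h (x + y) * mollifier p (1^2) y = H (x + y) * mollifier p (1^2) (x - (x + y))"
      using sub[of y] mollifier_vanishes[of 1 y p] mollifier_minus[of 1 p y]
      by (cases "norm y \<le> 1") (auto simp: H_def)
  qed
  also have "\<dots> = (\<integral>z. H z * mollifier p (1^2) (x - z) \<partial>lborel)"
  proof (rule integral_translate)
    have "(\<lambda>z. mollifier p (1^2) (x - z)) \<in> borel_measurable borel"
      by (intro borel_measurable_continuous_onI continuous_on_compose2[OF Ck_on_continuous0[OF Ck_on_mollifier]] continuous_intros) auto
    then show "(\<lambda>z. H z * mollifier p (1^2) (x - z)) \<in> borel_measurable borel"
      using H by auto
  qed
  finally show ?thesis by (simp add: convolve_def)
qed

text \<open>As p is arbitrary, the first part is smoothness of \<open>h\<close>, starting from class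
  C^2. The second writes a derivative of \<open>h\<close> as an integral in which \<open>h\<close>
  itself is not differentiated.\<close>

lemma harmonic_derivatives:
  fixes h :: "'a::euclidean_space \<Rightarrow> real"
  assumes h: "harmonic_on h U" "cball 0 2 \<subseteq> U"
  defines "H \<equiv> \<lambda>z. indicator (cball 0 2) z *\<^sub>R h z"
  shows "Ck_on p h (ball 0 1)"
    and "set bs \<subseteq> Basis \<Longrightarrow> length bs \<le> p \<Longrightarrow>
      mollifier_mass p TYPE('a) * iter_partial bs h 0 = convolve H (iter_partial bs (mollifier p (1^2))) 0"
proof -
  have U: "open U" "Ck_on 2 h U" using h by (auto simp: harmonic_on_def)
  have H: "integrable lborel H"
    unfolding H_def using continuous_on_subset[OF Ck_on_continuous0[OF U(2)] h(2)]
    by (intro borel_integrable_compact) auto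
  let ?c = "mollifier_mass p TYPE('a)" and ?E = "mollifier p (1^2) :: 'a \<Rightarrow> real"
  have c: "?c \<noteq> 0" using mollifier_mass_pos[of p, where 'a = 'a] by simp
  have E: "Ck_on p ?E UNIV" "\<And>y. norm y > 1 \<Longrightarrow> ?E y = 0"
    using Ck_on_mollifier[of "1^2" p] mollifier_vanishes[of 1 _ p] by auto
  \<comment> \<open>The dummy summand 0 * 0 gives the right side the shape of
    \<open>Ck_on_linear\<close> and \<open>iter_partial_linear\<close>.\<close>
  have eq: "h x = 1 / ?c * convolve H ?E x + 0 * 0" if "x \<in> ball 0 1" for x
    using harmonic_eq_convolve[OF h that, of p] c by (simp add: H_def)
  have C: "Ck_on p (convolve H ?E) (ball 0 1)"
    by (rule Ck_on_mono[OF Ck_on_convolve[OF H E]]) auto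
  show "Ck_on p h (ball 0 1)"
    by (rule Ck_on_cong[OF open_ball eq Ck_on_linear[OF open_ball C Ck_on_const]])
  assume bs: "set bs \<subseteq> Basis" "length bs \<le> p"
  have "iter_partial bs h 0 = iter_partial bs (\<lambda>x. 1 / ?c * convolve H ?E x + 0 * 0) 0"
    by (rule iter_partial_cong[where U = "ball 0 1"]) (use eq in auto)
  also have "\<dots> = 1 / ?c * iter_partial bs (convolve H ?E) 0"
    using iter_partial_linear[OF open_ball C Ck_on_const bs, of 0 "1 / ?c" 0 0] by simp
  finally have "iter_partial bs h 0 = 1 / ?c * iter_partial bs (convolve H ?E) 0" .
  then show "?c * iter_partial bs h 0 = convolve H (iter_partial bs ?E) 0"
    using iter_partial_convolve[OF H E(1) _ bs, of 1] E(2) c by simp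
qed

section \<open>Jets of the fundamental solution\<close>


text \<open>In finite dimension a vector annihilated by every functional that annihilates a family
  lies in its span. \<open>C\<close> may be infinite while the combination is finite, so the
  induction removes coordinates, not vectors.\<close>

lemma finite_dim_duality:
  fixes \<tau> :: "'i \<Rightarrow> real" and g :: "'y \<Rightarrow> 'i \<Rightarrow> real"
  assumes "finite I"
    and "\<And>\<mu>. (\<And>y. y \<in> C \<Longrightarrow> (\<Sum>i\<in>I. \<mu> i * g y i) = 0) \<Longrightarrow> (\<Sum>i\<in>I. \<mu> i * \<tau> i) = 0"
  shows "\<exists>Y a. finite Y \<and> Y \<subseteq> C \<and> (\<forall>i\<in>I. \<tau> i = (\<Sum>y\<in>Y. a y * g y i))"
  using assms
proof (induction I arbitrary: \<tau> g rule: finite_induct)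
  case (insert k I)
  have sum_upd: "(\<Sum>i\<in>I. (if i = k then c else \<mu> i) * f i) = (\<Sum>i\<in>I. \<mu> i * f i)" for c \<mu> and f :: "'i \<Rightarrow> real"
    using insert.hyps by (intro sum.cong) auto
  show ?case
  proof (cases "\<exists>z\<in>C. g z k \<noteq> 0")
    \<comment> \<open>All vectors vanish in coordinate k; the functional that reads this coordinate
      shows that \<open>\<tau>\<close> vanishes there too.\<close>
    case False
    have "\<tau> k = 0"
    proof -
      have "(\<Sum>i\<in>insert k I. (if i = k then 1 else 0) * \<tau> i) = 0"
        by (rule insert.prems) (use False insert.hyps sum_upd[of 1 "\<lambda>_. 0"] in simp)
      then show ?thesis using insert.hyps sum_upd[of 1 "\<lambda>_. 0" \<tau>] by simp
    qed
    moreover have "\<exists>Y a. finite Y \<and> Y \<subseteq> C \<and> (\<forall>i\<in>I. \<tau> i = (\<Sum>y\<in>Y. a y * g y i))"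
    proof (rule insert.IH)
      fix \<mu> assume \<mu>: "\<And>y. y \<in> C \<Longrightarrow> (\<Sum>i\<in>I. \<mu> i * g y i) = 0"
      have "(\<Sum>i\<in>insert k I. (if i = k then 0 else \<mu> i) * \<tau> i) = 0"
        by (rule insert.prems) (use \<mu> insert.hyps sum_upd in simp)
      then show "(\<Sum>i\<in>I. \<mu> i * \<tau> i) = 0" using insert.hyps sum_upd by simp
    qed
    then obtain Y a where Y: "finite Y" "Y \<subseteq> C" "\<And>i. i \<in> I \<Longrightarrow> \<tau> i = (\<Sum>y\<in>Y. a y * g y i)" by metis
    moreover have "(\<Sum>y\<in>Y. a y * g y k) = 0"
      by (rule sum.neutral) (use False Y(2) in auto)
    ultimately show ?thesis by (intro exI[of _ Y] exI[of _ a]) auto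
  next
    case True
    \<comment> \<open>Gaussian elimination of the coordinate \<open>k\<close> with pivot \<open>g z\<close>.\<close>
    then obtain z where z: "z \<in> C" "g z k \<noteq> 0" by blast
    define g' where "g' y i = g y i - g y k / g z k * g z i" for y i
    define \<tau>' where "\<tau>' i = \<tau> i - \<tau> k / g z k * g z i" for i
    have "\<exists>Y a. finite Y \<and> Y \<subseteq> C \<and> (\<forall>i\<in>I. \<tau>' i = (\<Sum>y\<in>Y. a y * g' y i))"
    proof (rule insert.IH)
      fix \<mu> assume \<mu>: "\<And>y. y \<in> C \<Longrightarrow> (\<Sum>i\<in>I. \<mu> i * g' y i) = 0"
      \<comment> \<open>With this value at k the extended functional vanishes on the pivot
        \<open>g z\<close>.\<close>
      define c where "c = - (\<Sum>i\<in>I. \<mu> i * g z i) / g z k"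
      have eq: "(\<Sum>i\<in>insert k I. (if i = k then c else \<mu> i) * f i)
          = (\<Sum>i\<in>I. \<mu> i * (f i - f k / g z k * g z i))" for f
      proof -
        have "(\<Sum>i\<in>I. \<mu> i * (f i - f k / g z k * g z i)) = (\<Sum>i\<in>I. \<mu> i * f i) - f k / g z k * (\<Sum>i\<in>I. \<mu> i * g z i)"
          by (simp add: right_diff_distrib sum_subtractf sum_distrib_left mult_ac)
        also have "\<dots> = (\<Sum>i\<in>I. \<mu> i * f i) + c * f k" by (simp add: c_def)
        finally show ?thesis using insert.hyps sum_upd by simp
      qed
      have "(\<Sum>i\<in>insert k I. (if i = k then c else \<mu> i) * \<tau> i) = 0"
        by (rule insert.prems) (use \<mu> in \<open>simp only: eq g'_def\<close>)
      then show "(\<Sum>i\<in>I. \<mu> i * \<tau>' i) = 0" unfolding eq \<tau>'_def .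
    qed
    then obtain Y a where Y: "finite Y" "Y \<subseteq> C" "\<And>i. i \<in> I \<Longrightarrow> \<tau>' i = (\<Sum>y\<in>Y. a y * g' y i)" by metis
    \<comment> \<open>Collects the multiples of \<open>g z\<close> that were subtracted from
      \<open>\<tau>\<close> and from the vectors \<open>g y\<close>.\<close>
    define \<kappa> where "\<kappa> = \<tau> k / g z k - (\<Sum>y\<in>Y. a y * (g y k / g z k))"
    \<comment> \<open>The pivot may already belong to \<open>Y\<close>, so its coefficient is added
      to the old one.\<close>
    define a' where "a' y = (if y \<in> Y then a y else 0) + (if y = z then \<kappa> else 0)" for y
    have rep: "(\<Sum>y\<in>insert z Y. a' y * g y i) = (\<Sum>y\<in>Y. a y * g y i) + \<kappa> * g z i" for i
    proof -
      have "(\<Sum>y\<in>insert z Y. a' y * g y i) = (\<Sum>y\<in>insert z Y. (if y \<in> Y then a y * g y i else 0) + (if y = z then \<kappa> * g y i else 0))"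
        by (intro sum.cong) (auto simp: a'_def algebra_simps)
      also have "\<dots> = (\<Sum>y\<in>insert z Y. if y \<in> Y then a y * g y i else 0) + (\<Sum>y\<in>insert z Y. if y = z then \<kappa> * g y i else 0)"
        by (rule sum.distrib)
      also have "(\<Sum>y\<in>insert z Y. if y \<in> Y then a y * g y i else 0) = (\<Sum>y\<in>Y. a y * g y i)"
        using Y(1) by (simp flip: sum.inter_filter add: sum.If_cases) (intro sum.cong, auto)
      also have "(\<Sum>y\<in>insert z Y. if y = z then \<kappa> * g y i else 0) = \<kappa> * g z i"
        using Y(1) by simp
      finally show ?thesis .
    qed
    have g'_sum: "(\<Sum>y\<in>Y. a y * g' y i) = (\<Sum>y\<in>Y. a y * g y i) - (\<Sum>y\<in>Y. a y * (g y k / g z k)) * g z i" for i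
      by (simp add: g'_def right_diff_distrib sum_subtractf sum_distrib_left mult_ac)
    have "\<tau> i = (\<Sum>y\<in>insert z Y. a' y * g y i)" if "i \<in> insert k I" for i
    proof -
      \<comment> \<open>Elimination makes both sides 0 at i = k, so the equation extends to that
        coordinate.\<close>
      have "\<tau>' i = (\<Sum>y\<in>Y. a y * g' y i)"
        using that Y(3) z(2) by (auto simp: \<tau>'_def g'_def)
      then show ?thesis unfolding g'_sum rep \<tau>'_def \<kappa>_def by (simp add: algebra_simps)
    qed
    then show ?thesis using Y(1,2) z(1) by (intro exI[of _ "insert z Y"] exI[of _ a']) auto
  qed
qed auto

section \<open>Polynomials and the derivatives of the fundamental solution\<close>

text \<open>On the line from \<open>a\<close> through x the restriction is a polynomial in one
  variable with infinitely many roots near \<open>a\<close>.\<close>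

lemma real_polynomial_function_vanishes:
  fixes q :: "'a::euclidean_space \<Rightarrow> real"
  assumes q: "real_polynomial_function q" and S: "open S" "a \<in> S" "\<And>x. x \<in> S \<Longrightarrow> q x = 0"
  shows "q x = 0"
proof -
  have "polynomial_function (\<lambda>t::real. a + t *\<^sub>R (x - a))"
    by (intro polynomial_function_add polynomial_function_mult polynomial_function_const polynomial_function_id)
  from real_polynomial_function_compose[OF this q]
  obtain c N where c: "\<And>t. q (a + t *\<^sub>R (x - a)) = (\<Sum>i\<le>N. c i * t ^ i)"
    using real_polynomial_function_imp_sum by (fastforce simp: comp_def fun_eq_iff)
  obtain d where d: "d > 0" "\<And>t. dist t 0 < d \<Longrightarrow> a + t *\<^sub>R (x - a) \<in> S"
    using eventually_line_in_open[OF S(1,2), of "x - a"] by (auto simp: eventually_nhds_metric)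
  have "{0<..<d} \<subseteq> {t. (\<Sum>i\<le>N. c i * t ^ i) = 0}"
    using d S(3) by (auto simp flip: c)
  then have "infinite {t. (\<Sum>i\<le>N. c i * t ^ i) = 0}"
    using d(1) infinite_Ioo finite_subset by blast
  then have "\<forall>i\<le>N. c i = 0" using polyfun_finite_roots[of c N] by blast
  then show ?thesis using c[of 1] by simp
qed

lemma real_polynomial_function_line_derivative:
  fixes q :: "'a::euclidean_space \<Rightarrow> real"
  assumes "real_polynomial_function q"
  shows "\<exists>q'. real_polynomial_function q' \<and>
    (\<forall>x. ((\<lambda>t. q (x + t *\<^sub>R b)) has_real_derivative q' x) (at 0))"
  using assms
proof induction
  case (linear f)
  then interpret bounded_linear f .
  have "((\<lambda>t. f (x + t *\<^sub>R b)) has_real_derivative f b) (at 0)" for x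
    by (auto intro!: derivative_eq_intros simp: add scaleR)
  then show ?case by blast
next
  case (const c)
  then show ?case by (intro exI[of _ "\<lambda>_. 0"]) auto
next
  case (add f g)
  then obtain f' g' where "real_polynomial_function f'" "real_polynomial_function g'"
    "\<And>x. ((\<lambda>t. f (x + t *\<^sub>R b)) has_real_derivative f' x) (at 0)"
    "\<And>x. ((\<lambda>t. g (x + t *\<^sub>R b)) has_real_derivative g' x) (at 0)" by blast
  then show ?case by (intro exI[of _ "\<lambda>x. f' x + g' x"]) (auto intro!: DERIV_add)
next
  case (mult f g)
  then obtain f' g' where "real_polynomial_function f'" "real_polynomial_function g'"
    and d: "\<And>x. ((\<lambda>t. f (x + t *\<^sub>R b)) has_real_derivative f' x) (at 0)"
    "\<And>x. ((\<lambda>t. g (x + t *\<^sub>R b)) has_real_derivative g' x) (at 0)" by blast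
  moreover have "((\<lambda>t. f (x + t *\<^sub>R b) * g (x + t *\<^sub>R b)) has_real_derivative f' x * g x + f x * g' x) (at 0)" for x
    using DERIV_mult[OF d[of x]] by (simp add: algebra_simps)
  ultimately show ?case using mult.hyps
    by (intro exI[of _ "\<lambda>x. f' x * g x + f x * g' x"]) auto
qed

lemma real_polynomial_function_inner_self:
  "real_polynomial_function (\<lambda>x::'a::euclidean_space. x \<bullet> x)"
proof -
  have "(\<lambda>x::'a. x \<bullet> x) = (\<lambda>x. \<Sum>b\<in>Basis. (x \<bullet> b) * (x \<bullet> b))"
    by (rule ext) (rule euclidean_inner)
  moreover have "real_polynomial_function (\<lambda>x::'a. \<Sum>b\<in>Basis. (x \<bullet> b) * (x \<bullet> b))"
    by (intro real_polynomial_function_sum finite_Basis real_polynomial_function.intros(1,4) bounded_linear_inner_left)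
  ultimately show ?thesis by simp
qed

definition fund_sol :: "'a::euclidean_space \<Rightarrow> real" where
  "fund_sol x = fund DIM('a) 0 (x \<bullet> x)"

lemma Ck_on_fund_sol: "Ck_on k (fund_sol :: 'a::euclidean_space \<Rightarrow> real) (- {0})"
  unfolding fund_sol_def
  by (rule Ck_on_radial[where \<phi> = "fund DIM('a)"]) 
     (use DERIV_fund DERIV_isCont[OF DERIV_fund] in \<open>auto simp del: fund.simps\<close>)

lemma harmonic_on_fund_sol: "harmonic_on (fund_sol :: 'a::euclidean_space \<Rightarrow> real) (- {0})"
proof -
  have "laplacian (fund_sol :: 'a \<Rightarrow> real) x = 0" if "x \<noteq> 0" for x :: 'a
  proof -
    have "laplacian (fund_sol :: 'a \<Rightarrow> real) x
        = 2 * DIM('a) * fund DIM('a) (Suc 0) (x \<bullet> x) + 4 * (x \<bullet> x) * fund DIM('a) (Suc (Suc 0)) (x \<bullet> x)"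
      unfolding fund_sol_def
      by (rule laplacian_radial[of "- {0}"]) (rule DERIV_fund | use that in force)+
    then show ?thesis using fund_recurrence[of "x \<bullet> x" "DIM('a)" 0] that by (simp add: algebra_simps del: fund.simps)
  qed
  then show ?thesis unfolding harmonic_on_def using Ck_on_fund_sol by auto
qed

text \<open>At least one derivative is taken because in the plane the function itself is a
  logarithm. Each further derivative lowers the exponent of |x|^2 by one, which keeps the other
  factor polynomial.\<close>

lemma iter_partial_fund_sol:
  fixes bs :: "'a::euclidean_space list"
  shows "\<exists>q. real_polynomial_function q \<and> (\<forall>x\<noteq>0. iter_partial (bs @ [b]) fund_sol x
    = q x * (x \<bullet> x) powr (- (DIM('a) / 2) - length bs))"
proof (induction bs)
  case Nil
  have "iter_partial [b] fund_sol x = 2 * (x \<bullet> b) * (x \<bullet> x) powr (- (DIM('a) / 2) - 0)" if "x \<noteq> 0" for x :: 'a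
    using partial_deriv_eqI[OF DERIV_radial[OF DERIV_fund[of "x \<bullet> x" "DIM('a)" 0]], of b] that
    by (simp add: fund_sol_def[abs_def])
  moreover have "real_polynomial_function (\<lambda>x. 2 * (x \<bullet> b))"
    by (intro real_polynomial_function.intros bounded_linear_inner_left)
  ultimately show ?case by (intro exI[of _ "\<lambda>x. 2 * (x \<bullet> b)"]) simp
next
  case (Cons c bs)
  let ?\<alpha> = "- (DIM('a) / 2) - real (length bs)"
  obtain q where q: "real_polynomial_function q"
    "\<And>x. x \<noteq> 0 \<Longrightarrow> iter_partial (bs @ [b]) fund_sol x = q x * (x \<bullet> x) powr ?\<alpha>"
    using Cons.IH by auto
  obtain q' where q': "real_polynomial_function q'" "\<And>x. ((\<lambda>t. q (x + t *\<^sub>R c)) has_real_derivative q' x) (at 0)"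
    using real_polynomial_function_line_derivative[OF q(1)] by metis
  \<comment> \<open>The polynomial left by the product rule once the power with exponent
    \<open>?\<alpha> - 1\<close> is factored out.\<close>
  let ?r = "\<lambda>x. q' x * (x \<bullet> x) + (2 * ?\<alpha>) * ((x \<bullet> c) * q x)"
  have "real_polynomial_function ?r"
    using q(1) q'(1)
    by (intro real_polynomial_function_inner_self real_polynomial_function.intros(2-4)
        real_polynomial_function.intros(1)[OF bounded_linear_inner_left])
  moreover have "iter_partial ((c # bs) @ [b]) fund_sol x = ?r x * (x \<bullet> x) powr (- (DIM('a) / 2) - length (c # bs))"
    if x: "x \<noteq> 0" for x
  proof -
    have pos: "x \<bullet> x > 0" using x by simp
    have "iter_partial ((c # bs) @ [b]) fund_sol x = partial_deriv c (\<lambda>x. q x * (x \<bullet> x) powr ?\<alpha>) x"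
      using partial_deriv_cong[of "- {0}" x "iter_partial (bs @ [b]) fund_sol" "\<lambda>x. q x * (x \<bullet> x) powr ?\<alpha>" c] q(2) x
      by (simp add: open_Compl)
    also have "\<dots> = q' x * (x \<bullet> x) powr ?\<alpha> + (2 * (x \<bullet> c) * (?\<alpha> * (x \<bullet> x) powr (?\<alpha> - 1))) * q x"
      using DERIV_mult[OF q'(2)[of x] DERIV_radial[OF has_real_derivative_powr[OF pos, of ?\<alpha>], of c]]
      by (intro partial_deriv_eqI) simp
    also have "(x \<bullet> x) powr ?\<alpha> = (x \<bullet> x) * (x \<bullet> x) powr (?\<alpha> - 1)"
      using pos powr_add[of "x \<bullet> x" 1 "?\<alpha> - 1"] by simp
    finally show ?thesis by (simp add: algebra_simps)
  qed
  ultimately show ?case by blast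
qed

text \<open>Terms of lower order are brought to the common exponent -n/2 - m by multiplying their
  polynomials by powers of |x|^2.\<close>

lemma operator_fund_sol:
  fixes I :: "'a::euclidean_space list set"
  assumes "\<And>bs. bs \<in> I \<Longrightarrow> bs \<noteq> [] \<and> length bs \<le> m"
  shows "\<exists>q. real_polynomial_function q \<and> (\<forall>x\<noteq>0. (\<Sum>bs\<in>I. \<mu> bs * iter_partial bs fund_sol x)
    = q x * (x \<bullet> x) powr (- (DIM('a) / 2) - m))"
proof -
  have "\<exists>q. real_polynomial_function q \<and> (\<forall>x\<noteq>0. iter_partial bs fund_sol x
    = q x * (x \<bullet> x) powr (- (DIM('a) / 2) - m))" if bs: "bs \<in> I" for bs
  proof -
    obtain cs c where cs: "bs = cs @ [c]" using assms[OF bs] by (cases bs rule: rev_cases) auto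
    obtain q where q: "real_polynomial_function q"
      "\<And>x. x \<noteq> 0 \<Longrightarrow> iter_partial bs fund_sol x = q x * (x \<bullet> x) powr (- (DIM('a) / 2) - length cs)"
      using iter_partial_fund_sol[of cs c] unfolding cs by metis
    have "real_polynomial_function (\<lambda>x. q x * (x \<bullet> x) ^ (m - length cs))"
      using q(1) real_polynomial_function_inner_self by auto
    moreover have "iter_partial bs fund_sol x = q x * (x \<bullet> x) ^ (m - length cs) * (x \<bullet> x) powr (- (DIM('a) / 2) - m)"
      if x: "x \<noteq> 0" for x
    proof -
      have "length cs \<le> m" using assms[OF bs] cs by simp
      then have "real (m - length cs) + (- (DIM('a) / 2) - m) = - (DIM('a) / 2) - length cs"
        by (simp add: of_nat_diff)
      moreover have "(x \<bullet> x) ^ (m - length cs) * (x \<bullet> x) powr (- (DIM('a) / 2) - m)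
          = (x \<bullet> x) powr (real (m - length cs) + (- (DIM('a) / 2) - m))"
        unfolding powr_add using x by (simp add: powr_realpow)
      ultimately have "(x \<bullet> x) ^ (m - length cs) * (x \<bullet> x) powr (- (DIM('a) / 2) - m)
          = (x \<bullet> x) powr (- (DIM('a) / 2) - length cs)" by (simp only:)
      then show ?thesis using q(2)[OF x] by (simp add: mult.assoc)
    qed
    ultimately show ?thesis by blast
  qed
  then obtain Q where Q: "\<And>bs. bs \<in> I \<Longrightarrow> real_polynomial_function (Q bs)"
    "\<And>bs x. bs \<in> I \<Longrightarrow> x \<noteq> 0 \<Longrightarrow> iter_partial bs fund_sol x = Q bs x * (x \<bullet> x) powr (- (DIM('a) / 2) - m)"
    by metis
  show ?thesis
  proof (cases "finite I")
    case True
    then have "real_polynomial_function (\<lambda>x. \<Sum>bs\<in>I. \<mu> bs * Q bs x)"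
      using Q(1) by (intro real_polynomial_function_sum) auto
    moreover have "(\<Sum>bs\<in>I. \<mu> bs * iter_partial bs fund_sol x)
        = (\<Sum>bs\<in>I. \<mu> bs * Q bs x) * (x \<bullet> x) powr (- (DIM('a) / 2) - m)" if "x \<noteq> 0" for x
      using Q(2)[OF _ that] by (simp add: sum_distrib_right mult.assoc)
    ultimately show ?thesis by blast
  next
    case False
    then show ?thesis by (intro exI[of _ "\<lambda>_. 0"]) auto
  qed
qed

text \<open>Unique continuation by algebra instead of analyticity: the polynomial factor vanishes on
  an open set, hence everywhere.\<close>

lemma operator_fund_sol_vanishes:
  fixes I :: "'a::euclidean_space list set"
  assumes "\<And>bs. bs \<in> I \<Longrightarrow> bs \<noteq> [] \<and> length bs \<le> m"
    and S: "open S" "a \<in> S" "0 \<notin> S" "\<And>x. x \<in> S \<Longrightarrow> (\<Sum>bs\<in>I. \<mu> bs * iter_partial bs fund_sol x) = 0"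
    and "x \<noteq> 0"
  shows "(\<Sum>bs\<in>I. \<mu> bs * iter_partial bs fund_sol x) = 0"
proof -
  obtain q where q: "real_polynomial_function q" "\<And>x. x \<noteq> 0 \<Longrightarrow> (\<Sum>bs\<in>I. \<mu> bs * iter_partial bs fund_sol x)
    = q x * (x \<bullet> x) powr (- (DIM('a) / 2) - m)"
    using operator_fund_sol[OF assms(1)] by metis
  have "q x = 0" if "x \<in> S" for x
  proof -
    have "x \<noteq> 0" using that S(3) by auto
    then show ?thesis using q(2)[of x] S(4)[OF that] by simp
  qed
  then show ?thesis using real_polynomial_function_vanishes[OF q(1) S(1,2)] q(2)[OF assms(6)] by simp
qed

section \<open>From operators annihilating the fundamental solution to jets of harmonic
  functions\<close>

lemma laplacian_sum:
  assumes "open U" "\<And>i. i \<in> A \<Longrightarrow> Ck_on 2 (f i) U" "x \<in> U"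
  shows "laplacian (\<lambda>x. \<Sum>i\<in>A. c i * f i x) x = (\<Sum>i\<in>A. c i * laplacian (f i) x)"
proof -
  have "laplacian (\<lambda>x. \<Sum>i\<in>A. c i * f i x) x = (\<Sum>b\<in>Basis. \<Sum>i\<in>A. c i * iter_partial [b, b] (f i) x)"
    unfolding laplacian_def
    by (rule sum.cong[OF refl], rule iter_partial_sum[OF assms(1,2) _ _ assms(3)]) auto
  also have "\<dots> = (\<Sum>i\<in>A. c i * laplacian (f i) x)"
    unfolding laplacian_def sum_distrib_left by (rule sum.swap)
  finally show ?thesis .
qed

lemma operator_harmonic_vanishes_0:
  fixes h :: "'a::euclidean_space \<Rightarrow> real"
  assumes h: "harmonic_on h U" "cball 0 2 \<subseteq> U"
    and I: "\<And>bs. bs \<in> I \<Longrightarrow> set bs \<subseteq> Basis \<and> length bs \<le> m"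
    and L: "\<And>x::'a. x \<noteq> 0 \<Longrightarrow> (\<Sum>bs\<in>I. \<mu> bs * iter_partial bs fund_sol x) = 0"
  shows "(\<Sum>bs\<in>I. \<mu> bs * iter_partial bs h 0) = 0"
proof -
  have U: "open U" "Ck_on 2 h U" "\<And>x. x \<in> U \<Longrightarrow> laplacian h x = 0" using h by (auto simp: harmonic_on_def)
  define H where "H = (\<lambda>z. indicator (cball 0 2) z *\<^sub>R h z)"
  have H: "integrable lborel H"
    unfolding H_def using continuous_on_subset[OF Ck_on_continuous0[OF U(2)] h(2)]
    by (intro borel_integrable_compact) auto
  let ?c = "mollifier_mass m TYPE('a)" and ?E = "mollifier m (1^2) :: 'a \<Rightarrow> real"
  let ?T = "trunc_sol m (1^2) :: 'a \<Rightarrow> real"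
  have E: "Ck_on m ?E UNIV" "\<And>y. norm y > 1 \<Longrightarrow> ?E y = 0"
    using Ck_on_mollifier[of "1^2" m] mollifier_vanishes[of 1 _ m] by auto
  have T: "Ck_on (m + 2) ?T UNIV" by (rule Ck_on_trunc_sol) simp
  have T2: "Ck_on 2 (iter_partial bs ?T) UNIV" if "bs \<in> I" for bs
    by (rule Ck_on_iter_partial[OF Ck_on_mono[OF T]]) (use I[OF that] in auto)
  \<comment> \<open>The operator applied to the truncated solution. Outside the unit ball truncation
    changes nothing, so there the hypothesis on \<open>fund_sol\<close> makes it 0.\<close>
  define \<psi> where "\<psi> = (\<lambda>x. \<Sum>bs\<in>I. \<mu> bs * iter_partial bs ?T x)"
  have \<psi>2: "Ck_on 2 \<psi> UNIV" unfolding \<psi>_def by (rule Ck_on_sum[OF open_UNIV T2])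
  have \<psi>_van: "\<psi> x = 0" if x: "norm x > 1" for x
  proof -
    have eq: "?T y = fund_sol y" if "y \<in> - cball 0 1" for y
    proof -
      have "1^2 < (norm y)^2" using that by (intro power_strict_mono) auto
      then show ?thesis by (simp add: trunc_sol_def trunc_fund_def fund_sol_def power2_norm_eq_inner)
    qed
    have "iter_partial bs ?T x = iter_partial bs fund_sol x" for bs
      by (rule iter_partial_cong[of "- cball 0 1"]) (use x eq in auto)
    moreover have "x \<noteq> 0" using x by auto
    ultimately show ?thesis unfolding \<psi>_def using L[of x] by simp
  qed
  have lap: "(\<Sum>bs\<in>I. \<mu> bs * iter_partial bs ?E x) = laplacian \<psi> x" for x
  proof -
    have "iter_partial bs ?E x = laplacian (iter_partial bs ?T) x" if "bs \<in> I" for bs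
      unfolding mollifier_def
      by (rule iter_partial_laplacian[OF open_UNIV _ Ck_on_mono[OF T]]) (use I[OF that] in auto)
    then show ?thesis
      unfolding \<psi>_def by (subst laplacian_sum[OF open_UNIV T2]) auto
  qed
  \<comment> \<open>The convolution at 0 evaluates its kernel at 0 - z, which calls for the
    reflected function.\<close>
  let ?\<psi> = "\<lambda>x. \<psi> (0 + (-1) *\<^sub>R x)"
  have lap': "laplacian ?\<psi> x = laplacian \<psi> (- x)" for x
    unfolding laplacian_def
    by (rule sum.cong[OF refl], subst iter_partial_affine[OF open_UNIV \<psi>2]) auto
  have lap'_van: "laplacian ?\<psi> x = 0" if "norm x > 1" for x
    unfolding laplacian_def
    by (rule sum.neutral, intro ballI, rule iter_partial_vanishes[of "- cball 0 1"]) (use that \<psi>_van in auto)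
  have int: "integrable lborel (\<lambda>z. H z * iter_partial bs ?E (0 - z))" if "bs \<in> I" for bs
  proof -
    have van: "iter_partial bs ?E y = 0" if "norm y > 1" for y
      using iter_partial_vanishes[of "- cball 0 1" ?E y bs] E(2) that by auto
    have c: "continuous_on UNIV (iter_partial bs ?E)" using Ck_on_continuous[OF E(1)] I[OF that] by auto
    obtain B where "\<And>y. \<bar>iter_partial bs ?E y\<bar> \<le> B" using continuous_vanishing_bounded[OF c van] by metis
    then show ?thesis by (rule integrable_convolve[OF H c])
  qed
  have "?c * (\<Sum>bs\<in>I. \<mu> bs * iter_partial bs h 0) = (\<Sum>bs\<in>I. \<mu> bs * convolve H (iter_partial bs ?E) 0)"
    unfolding sum_distrib_left
  proof (rule sum.cong[OF refl])
    fix bs assume "bs \<in> I"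
    then have "?c * iter_partial bs h 0 = convolve H (iter_partial bs ?E) 0"
      using harmonic_derivatives(2)[OF h, of bs m] I unfolding H_def by blast
    then show "?c * (\<mu> bs * iter_partial bs h 0) = \<mu> bs * convolve H (iter_partial bs ?E) 0"
      by (simp add: mult.left_commute)
  qed
  also have "\<dots> = (\<integral>z. (\<Sum>bs\<in>I. \<mu> bs * (H z * iter_partial bs ?E (0 - z))) \<partial>lborel)"
    unfolding convolve_def using int by (subst Bochner_Integration.integral_sum) auto
  also have "\<dots> = (\<integral>z. h z * laplacian ?\<psi> z \<partial>lborel)"
  proof (intro Bochner_Integration.integral_cong refl)
    fix z
    have "(\<Sum>bs\<in>I. \<mu> bs * (H z * iter_partial bs ?E (0 - z))) = H z * (\<Sum>bs\<in>I. \<mu> bs * iter_partial bs ?E (0 - z))"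
      by (simp add: sum_distrib_left mult_ac)
    also have "\<dots> = H z * laplacian ?\<psi> z" unfolding lap lap' by simp
    also have "\<dots> = h z * laplacian ?\<psi> z"
      using lap'_van[of z] by (cases "norm z \<le> 1") (auto simp: H_def)
    finally show "(\<Sum>bs\<in>I. \<mu> bs * (H z * iter_partial bs ?E (0 - z))) = h z * laplacian ?\<psi> z" .
  qed
  also have "\<dots> = (\<integral>z. laplacian h z * ?\<psi> z \<partial>lborel)"
  proof (rule integral_mult_laplacian[OF U(1) _ U(2), of 1])
    show "cball 0 1 \<subseteq> U" using h(2) by (auto simp: subset_iff)
    show "Ck_on 2 ?\<psi> UNIV" by (rule Ck_on_affine[OF open_UNIV \<psi>2 open_UNIV]) auto
  qed (use \<psi>_van in auto)
  \<comment> \<open>Wherever \<open>?\<psi>\<close> is nonzero, \<open>h\<close> is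
    harmonic.\<close>
  also have "(\<lambda>z. laplacian h z * ?\<psi> z) = (\<lambda>z. 0)"
  proof
    fix z show "laplacian h z * ?\<psi> z = 0"
      using \<psi>_van[of "- z"] U(3)[of z] h(2) by (cases "norm z \<le> 1") (auto simp: subset_iff)
  qed
  finally have "?c * (\<Sum>bs\<in>I. \<mu> bs * iter_partial bs h 0) = 0" by simp
  then show ?thesis using mollifier_mass_pos[of m, where 'a = 'a] by simp
qed

text \<open>One neighbourhood serves all orders k, since after rescaling the mollifiers of all
  classes have the same radius 1.\<close>

lemma harmonic_smooth:
  fixes h :: "'a::euclidean_space \<Rightarrow> real"
  assumes "harmonic_on h U" "x0 \<in> U"
  obtains d where "d > 0" "ball x0 d \<subseteq> U" "\<And>k. Ck_on k h (ball x0 d)"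
proof -
  have "open U" using assms(1) by (simp add: harmonic_on_def)
  then obtain e where e: "e > 0" "ball x0 e \<subseteq> U" using assms(2) openE by blast
  \<comment> \<open>Any fraction below 1/2 works: the ball of radius 2 d has to fit into that of
    radius e.\<close>
  define d where "d = e / 3"
  have d: "d > 0" using e by (simp add: d_def)
  let ?V = "(\<lambda>y. x0 + d *\<^sub>R y) -` U"
  have V: "open ?V" by (intro open_vimage \<open>open U\<close> continuous_intros)
  have "cball 0 2 \<subseteq> ?V"
  proof
    fix y :: 'a assume "y \<in> cball 0 2"
    then have "norm (d *\<^sub>R y) \<le> d * 2" using d by (auto intro!: mult_left_mono)
    then have "dist x0 (x0 + d *\<^sub>R y) < e" using e(1) unfolding d_def dist_norm by simp
    then show "y \<in> ?V" using e(2) by auto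
  qed
  from harmonic_derivatives(1)[OF harmonic_on_affine[OF assms(1) V] this, of x0 d]
  have C: "Ck_on k (\<lambda>y. h (x0 + d *\<^sub>R y)) (ball 0 1)" for k by simp
  have "Ck_on k h (ball x0 d)" for k
  proof (rule Ck_on_cong[OF open_ball])
    show "Ck_on k (\<lambda>x. (\<lambda>y. h (x0 + d *\<^sub>R y)) (- (1/d) *\<^sub>R x0 + (1/d) *\<^sub>R x)) (ball x0 d)"
    proof (rule Ck_on_affine[OF open_ball C open_ball])
      fix x assume "x \<in> ball x0 d"
      then have "norm (x - x0) < d" by (simp add: dist_norm norm_minus_commute)
      then have "norm ((1/d) *\<^sub>R (x - x0)) < 1" using d by simp
      moreover have "- (1/d) *\<^sub>R x0 + (1/d) *\<^sub>R x = (1/d) *\<^sub>R (x - x0)" by (simp add: algebra_simps)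
      ultimately show "- (1/d) *\<^sub>R x0 + (1/d) *\<^sub>R x \<in> ball 0 1" by (simp only: mem_ball_0)
    qed
  qed (use d in \<open>simp add: algebra_simps\<close>)
  moreover have "ball x0 d \<subseteq> U" using e by (auto simp: d_def)
  ultimately show ?thesis using d that by blast
qed

text \<open>Applied to y -> h (x0 + s y), the operator yields at 0 a polynomial in s whose
  coefficients are the contributions of the single degrees. It vanishes for all small s > 0, so
  every coefficient is 0.\<close>

lemma operator_harmonic_vanishes:
  fixes h :: "'a::euclidean_space \<Rightarrow> real"
  assumes h: "harmonic_on h U" "x0 \<in> U"
    and I: "finite I" "\<And>bs. bs \<in> I \<Longrightarrow> set bs \<subseteq> Basis \<and> length bs \<le> m"
    and L: "\<And>x::'a. x \<noteq> 0 \<Longrightarrow> (\<Sum>bs\<in>I. \<mu> bs * iter_partial bs fund_sol x) = 0"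
  shows "(\<Sum>bs\<in>I. if length bs = k then \<mu> bs * iter_partial bs h x0 else 0) = 0"
proof -
  obtain d where d: "d > 0" "ball x0 d \<subseteq> U" "\<And>k. Ck_on k h (ball x0 d)"
    using harmonic_smooth[OF h] by blast
  have "open U" using h(1) by (simp add: harmonic_on_def)
  define A where "A j = (\<Sum>bs\<in>I. if length bs = j then \<mu> bs * iter_partial bs h x0 else 0)" for j
  \<comment> \<open>The bound on s keeps x0 + s y inside the ball of radius d for norm y <=
    2.\<close>
  have "(\<Sum>j\<le>m. A j * s ^ j) = 0" if s: "0 < s" "s < d / 2" for s
  proof -
    let ?V = "(\<lambda>y. x0 + s *\<^sub>R y) -` U"
    have V: "open ?V" by (intro open_vimage \<open>open U\<close> continuous_intros)
    have "cball 0 2 \<subseteq> ?V"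
    proof
      fix y :: 'a assume "y \<in> cball 0 2"
      then have "s * norm y \<le> s * 2" using s by (intro mult_left_mono) auto
      moreover have "dist x0 (x0 + s *\<^sub>R y) = s * norm y" using s by (simp add: dist_norm)
      ultimately have "dist x0 (x0 + s *\<^sub>R y) < d" using s by linarith
      then show "y \<in> ?V" using d(2) by auto
    qed
    from operator_harmonic_vanishes_0[OF harmonic_on_affine[OF h(1) V] this I(2) L]
    have "0 = (\<Sum>bs\<in>I. \<mu> bs * iter_partial bs (\<lambda>y. h (x0 + s *\<^sub>R y)) 0)" by simp
    also have "\<dots> = (\<Sum>bs\<in>I. \<mu> bs * (s ^ length bs * iter_partial bs h x0))"
    proof (rule sum.cong[OF refl])
      fix bs assume "bs \<in> I"
      then have "iter_partial bs (\<lambda>y. h (x0 + s *\<^sub>R y)) 0 = s ^ length bs * iter_partial bs h (x0 + s *\<^sub>R 0)"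
        using I(2) d(1) by (intro iter_partial_affine[OF open_ball d(3)]) auto
      then show "\<mu> bs * iter_partial bs (\<lambda>y. h (x0 + s *\<^sub>R y)) 0 = \<mu> bs * (s ^ length bs * iter_partial bs h x0)" by simp
    qed
    also have "\<dots> = (\<Sum>bs\<in>I. \<Sum>j\<le>m. (if length bs = j then \<mu> bs * iter_partial bs h x0 else 0) * s ^ j)"
    proof (rule sum.cong[OF refl])
      fix bs assume bs: "bs \<in> I"
      have "(\<Sum>j\<le>m. (if length bs = j then \<mu> bs * iter_partial bs h x0 else 0) * s ^ j)
          = (\<Sum>j\<le>m. if j = length bs then \<mu> bs * iter_partial bs h x0 * s ^ j else 0)"
        by (intro sum.cong) auto
      also have "\<dots> = \<mu> bs * iter_partial bs h x0 * s ^ length bs"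
        using I(2)[OF bs] by simp
      finally show "\<mu> bs * (s ^ length bs * iter_partial bs h x0) =
        (\<Sum>j\<le>m. (if length bs = j then \<mu> bs * iter_partial bs h x0 else 0) * s ^ j)" by (simp add: mult_ac)
    qed
    also have "\<dots> = (\<Sum>j\<le>m. A j * s ^ j)"
      unfolding A_def sum_distrib_right by (rule sum.swap)
    finally show ?thesis by simp
  qed
  then have "{0<..<d/2} \<subseteq> {s. (\<Sum>j\<le>m. A j * s ^ j) = 0}" by auto
  then have "infinite {s. (\<Sum>j\<le>m. A j * s ^ j) = 0}"
    using d(1) by (meson finite_subset infinite_Ioo half_gt_zero)
  then have "\<forall>j\<le>m. A j = 0" using polyfun_finite_roots[of A m] by blast
  moreover have "A k = 0" if "k > m"
    unfolding A_def by (rule sum.neutral) (use I(2) that in force)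
  ultimately show ?thesis unfolding A_def[symmetric] by (cases "k \<le> m") auto
qed

lemma finite_bounded_lists: "finite {bs :: 'a::euclidean_space list. set bs \<subseteq> Basis \<and> bs \<noteq> [] \<and> length bs \<le> m}"
  by (rule finite_subset[OF _ finite_lists_length_le[OF finite_Basis, of m]]) auto

text \<open>\<open>iter_partial bs fund_sol (- y)\<close> is the derivative at 0 of the translate
  with pole y. The target jet is that of \<open>h\<close> in degree k and 0 in the other degrees
  from 1 to m; order 0 is left to a constant.\<close>

lemma harmonic_jet_in_span:
  fixes h :: "'a::euclidean_space \<Rightarrow> real"
  assumes h: "harmonic_on h U" "x0 \<in> U" and C: "open C" "c \<in> C" "0 \<notin> C"
  shows "\<exists>Y a. finite Y \<and> Y \<subseteq> C \<and> (\<forall>bs. set bs \<subseteq> Basis \<and> bs \<noteq> [] \<and> length bs \<le> m \<longrightarrow>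
    (\<Sum>y\<in>Y. a y * iter_partial bs fund_sol (- y)) = (if length bs = k then iter_partial bs h x0 else 0))"
proof -
  let ?I = "{bs :: 'a list. set bs \<subseteq> Basis \<and> bs \<noteq> [] \<and> length bs \<le> m}"
  have "\<exists>Y a. finite Y \<and> Y \<subseteq> C \<and> (\<forall>bs\<in>?I. (if length bs = k then iter_partial bs h x0 else 0)
      = (\<Sum>y\<in>Y. a y * iter_partial bs fund_sol (- y)))"
  proof (rule finite_dim_duality[OF finite_bounded_lists])
    fix \<mu> assume \<mu>: "\<And>y. y \<in> C \<Longrightarrow> (\<Sum>bs\<in>?I. \<mu> bs * iter_partial bs fund_sol (- y)) = 0"
    have "(\<Sum>bs\<in>?I. \<mu> bs * iter_partial bs fund_sol x) = 0" if "x \<noteq> 0" for x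
    \<comment> \<open>The operator is known to vanish at - y for y in \<open>C\<close>, that is, on
      the reflected open set.\<close>
    proof (rule operator_fund_sol_vanishes[of ?I m "uminus ` C" "- c"])
      show "open (uminus ` C)" using C(1) by (rule open_negations)
    qed (use \<mu> C that in auto)
    from operator_harmonic_vanishes[OF h finite_bounded_lists _ this, where m = m and k = k]
    have "(\<Sum>bs\<in>?I. if length bs = k then \<mu> bs * iter_partial bs h x0 else 0) = 0" by auto
    also have "(\<Sum>bs\<in>?I. if length bs = k then \<mu> bs * iter_partial bs h x0 else 0)
        = (\<Sum>bs\<in>?I. \<mu> bs * (if length bs = k then iter_partial bs h x0 else 0))"
      by (intro sum.cong) auto
    finally show "(\<Sum>bs\<in>?I. \<mu> bs * (if length bs = k then iter_partial bs h x0 else 0)) = 0" .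
  qed
  then obtain Y a where "finite Y \<and> Y \<subseteq> C \<and> (\<forall>bs\<in>?I. (if length bs = k then iter_partial bs h x0 else 0)
      = (\<Sum>y\<in>Y. a y * iter_partial bs fund_sol (- y)))" by (elim exE)
  then show ?thesis by (intro exI[of _ Y] exI[of _ a]) simp
qed

section \<open>Approximation in the exterior of a cone\<close>


lemma harmonic_on_subset: "harmonic_on f U \<Longrightarrow> open V \<Longrightarrow> V \<subseteq> U \<Longrightarrow> harmonic_on f V"
  unfolding harmonic_on_def using Ck_on_mono by blast

lemma harmonic_on_sum:
  assumes "open U" "\<And>i. i \<in> A \<Longrightarrow> harmonic_on (f i) U"
  shows "harmonic_on (\<lambda>x. \<Sum>i\<in>A. c i * f i x) U"
  using assms laplacian_sum[of U A f] Ck_on_sum[of U A 2 f c] unfolding harmonic_on_def by simp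

lemma harmonic_on_linear:
  assumes "harmonic_on f U" "harmonic_on g U"
  shows "harmonic_on (\<lambda>x. \<alpha> * f x + \<beta> * g x) U"
proof -
  \<comment> \<open>The two-term case of \<open>harmonic_on_sum\<close>, indexed by the
    booleans.\<close>
  have "harmonic_on (\<lambda>x. \<Sum>i\<in>(UNIV::bool set). (if i then \<alpha> else \<beta>) * (if i then f else g) x) U"
  proof (rule harmonic_on_sum)
    show "open U" using assms(1) by (simp add: harmonic_on_def)
  qed (use assms in auto)
  then show ?thesis by (simp add: UNIV_bool add.commute)
qed

text \<open>Any growth slower than linear would do. In the plane ln u <= u - 1 with u = sqrt (norm
  w) yields the square root and the constant 4; in higher dimensions the function is bounded outside
  every ball around its pole.\<close>

lemma fund_sol_growth:
  assumes "d > 0" "DIM('a::euclidean_space) \<ge> 2"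
  shows "\<exists>A\<ge>0. \<forall>w::'a. norm w \<ge> d \<longrightarrow> \<bar>fund_sol w\<bar> \<le> A + 4 * sqrt (norm w)"
proof (cases "DIM('a) = 2")
  case True
  have "\<bar>fund_sol w\<bar> \<le> 2 * \<bar>ln d\<bar> + 4 * sqrt (norm w)" if "norm w \<ge> d" for w :: 'a
  proof -
    have pos: "norm w > 0" "sqrt (norm w) > 0" using that assms by auto
    have "ln (sqrt (norm w)) \<le> sqrt (norm w)" using ln_le_minus_one[OF pos(2)] by simp
    then have "ln (norm w) \<le> 2 * sqrt (norm w)" using pos by (simp add: ln_sqrt)
    moreover have "ln d \<le> ln (norm w)"
      by (subst ln_le_cancel_iff) (use pos that assms in auto)
    moreover have "fund_sol w = 2 * ln (norm w)"
      using pos by (simp add: fund_sol_def True dot_square_norm ln_realpow)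
    moreover have "0 \<le> sqrt (norm w)" by simp
    ultimately show ?thesis by arith
  qed
  then show ?thesis by (intro exI[of _ "2 * \<bar>ln d\<bar>"]) auto
next
  case False
  let ?\<beta> = "1 - DIM('a) / 2"
  have \<beta>: "?\<beta> < 0" using assms(2) False by simp
  have "\<bar>fund_sol w\<bar> \<le> (d^2) powr ?\<beta> / \<bar>?\<beta>\<bar> + 4 * sqrt (norm w)" if "norm w \<ge> d" for w :: 'a
  proof -
    have "\<bar>fund_sol w\<bar> = (norm w ^ 2) powr ?\<beta> / \<bar>?\<beta>\<bar>"
      using False by (simp add: fund_sol_def dot_square_norm)
    also have "\<dots> \<le> (d^2) powr ?\<beta> / \<bar>?\<beta>\<bar>"
      using \<beta> assms(1) that by (intro divide_right_mono powr_mono2' power_mono) auto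
    finally show ?thesis by (simp add: add_increasing2)
  qed
  then show ?thesis by (intro exI[of _ "(d^2) powr ?\<beta> / \<bar>?\<beta>\<bar>"]) auto
qed

section \<open>Cones and rescaled poles\<close>

text \<open>An infinite cone over the open cap: invariance under scaling lets the poles t y approach
  the vertex, openness serves the duality argument, and the truncation is respected by taking t
  small.\<close>

definition open_cone :: "'a::real_normed_vector \<Rightarrow> real \<Rightarrow> 'a set" where
  "open_cone e r = {y. y \<noteq> 0 \<and> dist e (y /\<^sub>R norm y) < r}"

lemma open_open_cone: "open (open_cone e r)"
proof -
  have "continuous_on (- {0}) (\<lambda>y. dist e (y /\<^sub>R norm y))"
    by (intro continuous_intros) auto
  then have "open ((\<lambda>y. dist e (y /\<^sub>R norm y)) -` {..<r} \<inter> - {0})"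
    by (subst (asm) continuous_on_open_vimage) auto
  moreover have "open_cone e r = (\<lambda>y. dist e (y /\<^sub>R norm y)) -` {..<r} \<inter> - {0}"
    by (auto simp: open_cone_def)
  ultimately show ?thesis by simp
qed

lemma open_cone_in_truncated_cone:
  assumes "y \<in> open_cone e r" "0 < t" "t * norm y \<le> \<rho>"
  shows "x0 + t *\<^sub>R y \<in> truncated_cone x0 \<rho> (spherical_cap e r)"
proof -
  have y: "y \<noteq> 0" "dist e (y /\<^sub>R norm y) < r" using assms(1) by (auto simp: open_cone_def)
  have eq: "(t *\<^sub>R y) /\<^sub>R norm (t *\<^sub>R y) = y /\<^sub>R norm y" using assms(2) by simp
  have "(t *\<^sub>R y) /\<^sub>R norm (t *\<^sub>R y) \<in> spherical_cap e r"
    unfolding eq using y by (simp add: spherical_cap_def)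
  moreover have "0 < norm (t *\<^sub>R y)" "norm (t *\<^sub>R y) \<le> \<rho>" using y(1) assms by auto
  ultimately show ?thesis unfolding truncated_cone_def by blast
qed

text \<open>Rescaled by 1/t about x0, the exterior cone reaches out to radius \<rho>/t and so
  contains a fixed ball around y as soon as t is small; the rescaled \<open>K\<close> avoids that
  ball.\<close>

lemma cone_distance:
  assumes "\<rho> > 0" "truncated_cone x0 \<rho> (spherical_cap e r) \<inter> K = {x0}" "y \<in> open_cone e r"
  obtains d t0 where "d > 0" "t0 > 0"
    "\<And>t x. 0 < t \<Longrightarrow> t < t0 \<Longrightarrow> x \<in> K \<Longrightarrow> d \<le> norm ((- (1 / t) *\<^sub>R x0 - y) + (1 / t) *\<^sub>R x)"
proof -
  obtain d' where d': "d' > 0" "ball y d' \<subseteq> open_cone e r"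
    using open_open_cone[of e r] assms(3) openE by blast
  \<comment> \<open>The bound 1 keeps the ball within norm y + 1 of the origin, which determines
    \<open>t0\<close>.\<close>
  define d where "d = min 1 d'"
  have d: "d > 0" "d \<le> 1" "ball y d \<subseteq> open_cone e r" using d' by (auto simp: d_def)
  define t0 where "t0 = \<rho> / (norm y + 1)"
  have pos: "norm y + 1 > 0" by (simp add: add_nonneg_pos)
  have t0: "t0 > 0" using assms(1) pos by (simp add: t0_def)
  have "d \<le> norm ((- (1 / t) *\<^sub>R x0 - y) + (1 / t) *\<^sub>R x)" if t: "0 < t" "t < t0" and x: "x \<in> K" for t x
  proof (rule ccontr)
    define z where "z = (1 / t) *\<^sub>R (x - x0)"
    assume "\<not> ?thesis"
    moreover have "(- (1 / t) *\<^sub>R x0 - y) + (1 / t) *\<^sub>R x = z - y" by (simp add: z_def algebra_simps)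
    ultimately have zy: "norm (z - y) < d" by (simp only: not_le)
    then have z: "z \<in> open_cone e r" using d(3) by (auto simp: dist_norm norm_minus_commute)
    have "norm z \<le> norm y + 1" using zy d(2) norm_triangle_ineq2[of z y] by linarith
    then have "t * norm z \<le> t * (norm y + 1)" using t by (intro mult_left_mono) auto
    also have "\<dots> \<le> \<rho>" using t(2) pos by (simp add: t0_def field_simps)
    finally have "x0 + t *\<^sub>R z \<in> truncated_cone x0 \<rho> (spherical_cap e r)"
      by (intro open_cone_in_truncated_cone z t)
    moreover have xz: "x0 + t *\<^sub>R z = x" using t by (simp add: z_def)
    ultimately have "x = x0" using assms(2) x by auto
    \<comment> \<open>The vertex corresponds to z = 0, which the open cone excludes.\<close>
    then show False using z by (simp add: z_def open_cone_def)
  qed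
  then show ?thesis using that d t0 by blast
qed

text \<open>With w the argument of \<open>fund_sol\<close>, t norm w stays bounded on
  \<open>K\<close>, so t sqrt (norm w) is of order sqrt t. The factor t comes from t^k with k >=
  1.\<close>

lemma scaled_fund_sol_small:
  fixes K :: "'a::euclidean_space set"
  assumes "DIM('a) \<ge> 2" "compact K" 
    and cone: "\<rho> > 0" "truncated_cone x0 \<rho> (spherical_cap e r) \<inter> K = {x0}" "y \<in> open_cone e r"
    and k: "k \<ge> 1" and \<delta>: "\<delta> > 0"
  shows "\<forall>\<^sub>F t in at_right 0. \<forall>x\<in>K. x \<noteq> x0 + t *\<^sub>R y \<and>
    \<bar>(t ^ k * a) * (fund_sol ((- (1 / t) *\<^sub>R x0 - y) + (1 / t) *\<^sub>R x) - fund_sol (- y))\<bar> \<le> \<delta>"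
proof -
  obtain d t0 where d: "d > 0" "t0 > 0"
    "\<And>t x. 0 < t \<Longrightarrow> t < t0 \<Longrightarrow> x \<in> K \<Longrightarrow> d \<le> norm ((- (1 / t) *\<^sub>R x0 - y) + (1 / t) *\<^sub>R x)"
    using cone_distance[OF cone] by blast
  obtain A where A: "A \<ge> 0" "\<And>w::'a. norm w \<ge> d \<Longrightarrow> \<bar>fund_sol w\<bar> \<le> A + 4 * sqrt (norm w)"
    using fund_sol_growth[OF d(1) assms(1)] by blast
  obtain R where R: "\<And>x. x \<in> K \<Longrightarrow> norm (x - x0) \<le> R"
    using compact_imp_bounded[OF assms(2)] unfolding bounded_any_center[of K x0]
    by (metis dist_norm norm_minus_commute)
  define A' where "A' = A + \<bar>fund_sol (- y)\<bar>"
  \<comment> \<open>Bounds t norm w = norm (x - x0 - t y) for 0 < t < 1.\<close>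
  define R' where "R' = R + norm y"
  have "((\<lambda>t. \<bar>a\<bar> * (t * A' + 4 * sqrt (t * R'))) \<longlongrightarrow> \<bar>a\<bar> * (0 * A' + 4 * sqrt (0 * R'))) (at_right 0)"
    by (intro tendsto_intros)
  then have "\<forall>\<^sub>F t in at_right 0. \<bar>a\<bar> * (t * A' + 4 * sqrt (t * R')) < \<delta>"
    using \<delta> by (auto dest: order_tendstoD(2))
  moreover have "\<forall>\<^sub>F t in at_right 0. 0 < t \<and> t < min 1 t0"
    using d(2) by (auto simp: eventually_at_right_field intro!: exI[of _ "min 1 t0"])
  ultimately show ?thesis
  proof eventually_elim
    case (elim t)
    then have t: "0 < t" "t < 1" "t < t0" by auto
    show ?case
    proof
      fix x assume x: "x \<in> K"
      define w where "w = (- (1 / t) *\<^sub>R x0 - y) + (1 / t) *\<^sub>R x"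
      have w: "d \<le> norm w" unfolding w_def by (rule d(3)[OF t(1,3) x])
      have tw: "t *\<^sub>R w = (x - x0) - t *\<^sub>R y" using t(1) by (simp add: w_def algebra_simps)
      have "t * norm w = norm (t *\<^sub>R w)" using t(1) by simp
      also have "\<dots> \<le> norm (x - x0) + norm (t *\<^sub>R y)" unfolding tw by (rule norm_triangle_ineq4)
      also have "\<dots> \<le> R'" using R[OF x] t by (auto simp: R'_def mult_left_le_one_le intro!: add_mono)
      finally have "t * norm w \<le> R'" .
      then have "t * (t * norm w) \<le> t * R'" using t(1) by (intro mult_left_mono) auto
      then have "sqrt (t * (t * norm w)) \<le> sqrt (t * R')" by simp
      moreover have "sqrt (t * (t * norm w)) = t * sqrt (norm w)"
        using t(1) by (simp add: real_sqrt_mult)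
      ultimately have s: "t * sqrt (norm w) \<le> sqrt (t * R')" by simp
      have "t ^ k \<le> t" using t k power_decreasing[of 1 k t] by simp
      have "\<bar>(t ^ k * a) * (fund_sol w - fund_sol (- y))\<bar> = t ^ k * \<bar>a\<bar> * \<bar>fund_sol w - fund_sol (- y)\<bar>"
        using t(1) by (simp add: abs_mult)
      also have "\<dots> \<le> t * \<bar>a\<bar> * (A' + 4 * sqrt (norm w))"
      proof (intro mult_mono)
        show "\<bar>fund_sol w - fund_sol (- y)\<bar> \<le> A' + 4 * sqrt (norm w)"
          using A(2)[OF w] unfolding A'_def by linarith
      qed (use t \<open>t ^ k \<le> t\<close> in auto)
      also have "\<dots> = \<bar>a\<bar> * (t * A' + 4 * (t * sqrt (norm w)))" by (simp add: algebra_simps)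
      also have "\<dots> \<le> \<bar>a\<bar> * (t * A' + 4 * sqrt (t * R'))" using s by (intro mult_left_mono add_left_mono) auto
      also have "\<dots> \<le> \<delta>" using elim by simp
      finally have "\<bar>(t ^ k * a) * (fund_sol w - fund_sol (- y))\<bar> \<le> \<delta>" .
      moreover have "x \<noteq> x0 + t *\<^sub>R y"
      proof
        assume "x = x0 + t *\<^sub>R y"
        then have "t *\<^sub>R w = 0" using tw by simp
        then show False using w d(1) t(1) by simp
      qed
      ultimately show "x \<noteq> x0 + t *\<^sub>R y \<and> \<bar>(t ^ k * a) *
          (fund_sol ((- (1 / t) *\<^sub>R x0 - y) + (1 / t) *\<^sub>R x) - fund_sol (- y))\<bar> \<le> \<delta>"
        unfolding w_def by blast
    qed
  qed
qed

section \<open>Assembling the approximant\<close>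

lemma harmonic_approximation:
  fixes K :: "'a::euclidean_space set"
  assumes "DIM('a) \<ge> 2" "compact K" 
    and cone: "\<rho> > 0" "norm e = 1" "r > 0" "truncated_cone x0 \<rho> (spherical_cap e r) \<inter> K = {x0}"
    and h: "harmonic_near h K" "h x0 = 0" and \<delta>: "\<delta> > 0"
  shows "\<exists>g. harmonic_near g K \<and> (\<forall>bs. set bs \<subseteq> Basis \<and> length bs \<le> m \<longrightarrow> iter_partial bs g x0 = 0)
    \<and> (\<forall>x\<in>K. \<bar>h x - g x\<bar> \<le> \<delta>)"
proof -
  obtain U where U: "open U" "K \<subseteq> U" "harmonic_on h U" using h(1) by (auto simp: harmonic_near_def)
  have x0: "x0 \<in> K" "x0 \<in> U" using cone(4) U by auto
  obtain d where d: "d > 0" "ball x0 d \<subseteq> U" "\<And>k. Ck_on k h (ball x0 d)"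
    using harmonic_smooth[OF U(3) x0(2)] by blast
  let ?C = "open_cone e r"
  have "e \<in> ?C" "0 \<notin> ?C" using cone(2,3) by (auto simp: open_cone_def)
  from harmonic_jet_in_span[OF U(3) x0(2) open_open_cone this, of m]
  obtain Y a where Y: "\<And>k. finite (Y k)" "\<And>k. Y k \<subseteq> ?C"
    and jet: "\<And>k bs. set bs \<subseteq> Basis \<Longrightarrow> bs \<noteq> [] \<Longrightarrow> length bs \<le> m \<Longrightarrow>
      (\<Sum>y\<in>Y k. a k y * iter_partial bs fund_sol (- y)) = (if length bs = k then iter_partial bs h x0 else 0)"
    by metis
  \<comment> \<open>One t must serve all degrees and all poles, so they are gathered in a single
    finite index set.\<close>
  define P where "P = Sigma {1..m} Y"
  have P: "finite P" "\<And>k y. (k, y) \<in> P \<Longrightarrow> 1 \<le> k \<and> y \<in> ?C" using Y by (auto simp: P_def)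
  \<comment> \<open>The error is shared equally among the summands; the extra 1 keeps the quotient
    meaningful when there are none.\<close>
  define \<eta> where "\<eta> = \<delta> / (card P + 1)"
  have \<eta>: "\<eta> > 0" using \<delta> by (simp add: \<eta>_def)
  let ?F = "\<lambda>t p x. fund_sol ((- (1 / t) *\<^sub>R x0 - snd p) + (1 / t) *\<^sub>R x)"
  have "\<forall>\<^sub>F t in at_right 0. \<forall>p\<in>P. \<forall>x\<in>K. x \<noteq> x0 + t *\<^sub>R snd p \<and>
    \<bar>(t ^ fst p * a (fst p) (snd p)) * (?F t p x - fund_sol (- snd p))\<bar> \<le> \<eta>"
    using P by (intro eventually_ball_finite ballI scaled_fund_sol_small[OF assms(1,2) cone(1,4) _ _ \<eta>]) auto
  moreover have "\<forall>\<^sub>F t::real in at_right 0. 0 < t" by (rule eventually_at_right_less)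
  ultimately have "\<forall>\<^sub>F t in at_right 0. 0 < t \<and> (\<forall>p\<in>P. \<forall>x\<in>K. x \<noteq> x0 + t *\<^sub>R snd p \<and>
    \<bar>(t ^ fst p * a (fst p) (snd p)) * (?F t p x - fund_sol (- snd p))\<bar> \<le> \<eta>)"
    by eventually_elim auto
  from eventually_happens'[OF trivial_limit_at_right_real this]
  obtain t where t: "0 < t" and ne: "\<And>p x. p \<in> P \<Longrightarrow> x \<in> K \<Longrightarrow> x \<noteq> x0 + t *\<^sub>R snd p"
    and small: "\<And>p x. p \<in> P \<Longrightarrow> x \<in> K \<Longrightarrow>
      \<bar>(t ^ fst p * a (fst p) (snd p)) * (?F t p x - fund_sol (- snd p))\<bar> \<le> \<eta>"
    by (elim exE conjE) blast
  define c where "c p = t ^ fst p * a (fst p) (snd p)" for p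
  define f where "f p x = ?F t p x" for p :: "nat \<times> 'a" and x
  \<comment> \<open>This is the value of \<open>V\<close> at x0, where every rescaled argument
    reduces to minus the pole; hence \<open>W\<close> vanishes there.\<close>
  define \<kappa> where "\<kappa> = (\<Sum>p\<in>P. c p * fund_sol (- snd p))"
  define V where "V = (\<lambda>x. \<Sum>p\<in>P. c p * f p x)"
  \<comment> \<open>The products with 1 fit the linearity lemmas, the last 1 being a constant
    harmonic function.\<close>
  define W where "W = (\<lambda>x::'a. 1 * V x + (- \<kappa>) * 1)"
  define g where "g = (\<lambda>x. 1 * h x + (- 1) * W x)"
  define U' where "U' = U - (\<lambda>p. x0 + t *\<^sub>R snd p) ` P"
  have U': "open U'" "K \<subseteq> U'" "x0 \<in> U'" "U' \<subseteq> U"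
    unfolding U'_def using U P(1) ne x0 by (auto intro!: open_Diff finite_imp_closed)
  have arg: "(- (1 / t) *\<^sub>R x0 - snd p) + (1 / t) *\<^sub>R x \<in> - {0}" if "p \<in> P" "x \<in> U'" for p x
  proof
    assume "(- (1 / t) *\<^sub>R x0 - snd p) + (1 / t) *\<^sub>R x \<in> {0}"
    then have "t *\<^sub>R ((- (1 / t) *\<^sub>R x0 - snd p) + (1 / t) *\<^sub>R x) = 0" by simp
    then have "x = x0 + t *\<^sub>R snd p" using t by (simp add: algebra_simps)
    then show False using that by (auto simp: U'_def)
  qed
  have f_harm: "harmonic_on (f p) U'" if "p \<in> P" for p
    unfolding f_def by (rule harmonic_on_affine[OF harmonic_on_fund_sol U'(1) arg[OF that]])
  have W_harm: "harmonic_on W U'"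
    unfolding W_def V_def
    by (intro harmonic_on_linear harmonic_on_sum U' f_harm harmonic_on_const)
  have g_harm: "harmonic_on g U'"
    unfolding g_def by (intro harmonic_on_linear W_harm harmonic_on_subset[OF U(3)] U')
  define B where "B = ball x0 d \<inter> U'"
  have B: "open B" "x0 \<in> B" using U' d by (auto simp: B_def)
  have Ck: "Ck_on k h B" "\<And>p. p \<in> P \<Longrightarrow> Ck_on k (f p) B" for k
  proof -
    show "Ck_on k h B" by (rule Ck_on_mono[OF d(3)]) (auto simp: B_def)
    fix p assume p: "p \<in> P"
    show "Ck_on k (f p) B"
      unfolding f_def by (rule Ck_on_affine[OF _ Ck_on_fund_sol B(1) arg[OF p]]) (auto simp: B_def)
  qed
  have CkV: "Ck_on k V B" for k
    unfolding V_def by (rule Ck_on_sum[OF B(1) Ck(2)])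
  have CkW: "Ck_on k W B" for k
    unfolding W_def by (rule Ck_on_linear[OF B(1) CkV Ck_on_const])
  have "iter_partial bs g x0 = 0" if bs: "set bs \<subseteq> Basis" "length bs \<le> m" for bs
  proof (cases "bs = []")
    case True
    have "V x0 = \<kappa>" unfolding V_def \<kappa>_def f_def by simp
    then show ?thesis using True h(2) by (simp add: g_def W_def)
  next
    case False
    have "iter_partial bs V x0 = (\<Sum>p\<in>P. c p * iter_partial bs (f p) x0)"
      unfolding V_def by (rule iter_partial_sum[OF B(1) Ck(2) bs B(2)])
    also have "\<dots> = (\<Sum>p\<in>P. t ^ fst p * (1 / t) ^ length bs * (a (fst p) (snd p) * iter_partial bs fund_sol (- snd p)))"
    proof (rule sum.cong[OF refl])
      fix p assume p: "p \<in> P"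
      have "iter_partial bs (f p) x0 = (1 / t) ^ length bs *
          iter_partial bs fund_sol ((- (1 / t) *\<^sub>R x0 - snd p) + (1 / t) *\<^sub>R x0)"
        unfolding f_def by (rule iter_partial_affine[OF _ Ck_on_fund_sol bs(1) order_refl arg[OF p U'(3)]]) auto
      then show "c p * iter_partial bs (f p) x0 =
          t ^ fst p * (1 / t) ^ length bs * (a (fst p) (snd p) * iter_partial bs fund_sol (- snd p))"
        by (simp add: c_def)
    qed
    also have "\<dots> = (\<Sum>k\<in>{1..m}. \<Sum>y\<in>Y k. t ^ k * (1 / t) ^ length bs * (a k y * iter_partial bs fund_sol (- y)))"
      unfolding P_def using Y(1) by (simp add: sum.Sigma split_beta)
    also have "\<dots> = (\<Sum>k\<in>{1..m}. t ^ k * (1 / t) ^ length bs * (if length bs = k then iter_partial bs h x0 else 0))"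
      using jet[OF bs(1) False bs(2)] by (simp flip: sum_distrib_left)
    \<comment> \<open>The powers of t cancel exactly in degree k = length bs; the other degrees are
      0 by the choice of coefficients.\<close>
    also have "\<dots> = (\<Sum>k\<in>{1..m}. if k = length bs then iter_partial bs h x0 else 0)"
      using t by (intro sum.cong) (auto simp: power_one_over)
    also have "\<dots> = iter_partial bs h x0" using False bs(2) by (simp add: Suc_le_eq)
    finally have V: "iter_partial bs V x0 = iter_partial bs h x0" .
    have "iter_partial bs W x0 = iter_partial bs V x0"
      using iter_partial_linear[OF B(1) CkV Ck_on_const bs(1) order_refl B(2), of 1 "- \<kappa>" 1]
      unfolding W_def by (simp add: iter_partial_const[OF False])
    then show ?thesis
      using iter_partial_linear[OF B(1) Ck(1) CkW bs(1) order_refl B(2), of 1 "- 1"] V unfolding g_def by simp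
  qed
  moreover have "\<bar>h x - g x\<bar> \<le> \<delta>" if x: "x \<in> K" for x
  proof -
    have "h x - g x = (\<Sum>p\<in>P. c p * (f p x - fund_sol (- snd p)))"
      by (simp add: g_def W_def V_def \<kappa>_def right_diff_distrib sum_subtractf)
    also have "\<bar>\<dots>\<bar> \<le> (\<Sum>p\<in>P. \<eta>)"
      by (rule order_trans[OF sum_abs sum_mono]) (use small[OF _ x] in \<open>simp add: c_def f_def\<close>)
    also have "\<dots> \<le> \<delta>" using \<delta> by (simp add: \<eta>_def field_simps)
    finally show ?thesis .
  qed
  ultimately show ?thesis using g_harm U' unfolding harmonic_near_def by blast
qed

theorem theorem3:
  fixes K :: "(real ^ 'n) set" and x0 :: "real ^ 'n" and m :: nat
  assumes "CARD('n) \<ge> 2"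
    and "compact K"
    and "ext_cone_condition K x0"
    and "m \<ge> 1"
  shows "\<forall>f \<in> harm_space x0 K. \<forall>\<epsilon>>0. \<exists>g \<in> harm_space_order m x0 K.
           (SUP x\<in>K. \<bar>f x - g x\<bar>) < \<epsilon>"
proof (intro ballI allI impI)
  fix f and \<epsilon> :: real assume f: "f \<in> harm_space x0 K" and \<epsilon>: "0 < \<epsilon>"
  obtain \<rho> e r where cone: "\<rho> > 0" "norm e = 1" "r > 0"
    "truncated_cone x0 \<rho> (spherical_cap e r) \<inter> K = {x0}"
    using assms(3) unfolding ext_cone_condition_def by blast
  then have "x0 \<in> K" by auto
  obtain h where h: "harmonic_near h K" "f = restrict h K" and "f x0 = 0"
    using f by (auto simp: harm_space_def)
  then have "h x0 = 0" using \<open>x0 \<in> K\<close> by simp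
  moreover have "DIM(real ^ 'n) \<ge> 2" using assms(1) by simp
  ultimately obtain g where g: "harmonic_near g K"
    "\<forall>bs. set bs \<subseteq> Basis \<and> length bs \<le> m \<longrightarrow> iter_partial bs g x0 = 0"
    "\<And>x. x \<in> K \<Longrightarrow> \<bar>h x - g x\<bar> \<le> \<epsilon> / 2"
    using harmonic_approximation[OF _ assms(2) cone h(1), of "\<epsilon> / 2" m] \<epsilon> by (metis half_gt_zero)
  have "restrict g K \<in> harm_space_order m x0 K"
    using g(1,2) by (auto simp: harm_space_order_def)
  moreover have "(SUP x\<in>K. \<bar>f x - restrict g K x\<bar>) < \<epsilon>"
  proof -
    \<comment> \<open>Only the weak inequality passes to the supremum, hence the approximation to
      within \<epsilon> / 2; \<open>x0\<close> shows that \<open>K\<close> is nonempty.\<close>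
    have "(SUP x\<in>K. \<bar>f x - restrict g K x\<bar>) \<le> \<epsilon> / 2"
      using \<open>x0 \<in> K\<close> g(3) h(2) by (intro cSUP_least) auto
    then show ?thesis using \<epsilon> by simp
  qed
  ultimately show "\<exists>g \<in> harm_space_order m x0 K. (SUP x\<in>K. \<bar>f x - g x\<bar>) < \<epsilon>" by blast
qed

end
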